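(* Let $p_1<p_2$ be primes, $q=p_1p_2$, let $m_1,m_2>0$ be integers, $m=m_1+m_2$, $L=p_1^{m_1}p_2^{m_2}$, and let $0\le n_1\le m_1-1$, $0\le n_2\le m_2-1$. Let $J_1\subset\{1,\dots,m_1\}$ and $J_2\subset\{m_1+1,\dots,m\}$ with $|J_1|=n_1$, $|J_2|=n_2$. Let $f_i,f_i':\mathbb{Z}_q\to\mathbb{Z}_q$ ($i=1,\dots,m_1-n_1-1$) and $h_j,h_j':\mathbb{Z}_q\to\mathbb{Z}_q$ ($j=1,\dots,m_2-n_2-1$) be functions. For any choice of functions $f_0,h_0,g_\alpha,g'_\beta:\mathbb{Z}_q\to\mathbb{Z}_q$ ($\alpha=1,\dots,m_1-n_1$, $\beta=1,\dots,m_2-n_2$), of one-to-one mappings $\pi_c:\{1,\dots,m_1-n_1\}\to\{1,\dots,m_1\}\setminus J_1$ and $\pi_c':\{1,\dots,m_2-n_2\}\to\{m_1+1,\dots,m\}\setminus J_2$ (one pair for each $\mathbf{c}\in\mathbf{Z}_{p_1}^{n_1}\times\mathbf{Z}_{p_2}^{n_2}$), and of $\lambda\in\mathbb{Z}_q$, let $f:\mathbf{Z}_{p_1}^{m_1}\times\mathbf{Z}_{p_2}^{m_2}\to\mathbb{Z}_q$ be the function whose restriction to $\mathbf{x}_J=\mathbf{c}$, for each $\mathbf{c}\in\mathbf{Z}_{p_1}^{n_1}\times\mathbf{Z}_{p_2}^{n_2}$, is $$f|_{\mathbf{x}_J=\mathbf{c}}=\frac{q}{p_1}\sum_{i=1}^{m_1-n_1-1}f_i(x_{\pi_c(i)})f_i'(x_{\pi_c(i+1)})+\sum_{\alpha=1}^{m_1-n_1}g_\alpha(x_{\pi_c(\alpha)})+\frac{q}{p_2}\sum_{j=1}^{m_2-n_2-1}h_j(x_{\pi_c'(j)})h_j'(x_{\pi_c'(j+1)})+\sum_{\beta=1}^{m_2-n_2}g'_\beta(x_{\pi_c'(\beta)})+\lambda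 f_0(x_{\pi_c(m_1-n_1)})h_0(x_{\pi_c'(1)}).$$ For $0\le t<p_1^{n_1+1}p_2^{n_2+1}$, let $C_t$ be the set of $q$-ary functions $$f+\sum_{i=1}^2\frac{q}{p_i}(\mathbf{d}_i+\mathbf{t}_i)\cdot{\mathbf{x}_i}_{J_i}+\frac{q}{p_1}\big(d_{1,n_1+1}x_{\pi(1)}+t_{1,n_1+1}x_{\pi(m_1-n_1)}\big)+\frac{q}{p_2}\big(d_{2,n_2+1}x_{\pi'(1)}+t_{2,n_2+1}x_{\pi'(m_2-n_2)}\big)$$ with $\mathbf{d}_i\in\mathbf{Z}_{p_i}^{n_i}$, $d_{i,n_i+1}\in\mathbf{Z}_{p_i}$, $i=1,2$, where $\pi=\pi_c$ and $\pi'=\pi_c'$ whenever $\mathbf{x}_J=\mathbf{c}$; and let $\psi(C_t)$ be the corresponding code of sequences $\psi(F)$, $F\in C_t$. Then the set of codes $\mathcal{C}=\{\psi(C_t): 0\le t<p_1^{n_1+1}p_2^{n_2+1}\}$ forms $(p_1^{n_1+1}p_2^{n_2+1},L)$-CCCs if and only if $f_i,f_i'$ permute the set $\mathbf{Z}_{p_1}$ under modulo $p_1$ for all $i=1,\dots,m_1-n_1-1$, and $h_j,h_j'$ permute the set $\mathbf{Z}_{p_2}$ under modulo $p_2$ for all $j=1,\dots,m_2-n_2-1$.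
   Context: $\mathbb{Z}_q$ is the ring of integers modulo $q$, with elements represented by $0,1,\dots,q-1$; for $p\mid q$, $\mathbf{Z}_p=\{0,1,\dots,p-1\}\subset\mathbb{Z}_q$ (as a subset); arithmetic in values of $q$-ary functions is modulo $q$. $\xi_q=\exp(2\pi\sqrt{-1}/q)$. A function $\phi:\mathbb{Z}_q\to\mathbb{Z}_q$ permutes $\mathbf{Z}_p$ under modulo $p$ if the map $u\mapsto \phi(u)\bmod p$ is a bijection from $\mathbf{Z}_p$ to $\mathbf{Z}_p$. Variables and restriction: $\mathbf{x}=(\mathbf{x}_1,\mathbf{x}_2)$ with $\mathbf{x}_1=(x_1,\dots,x_{m_1})$, $\mathbf{x}_2=(x_{m_1+1},\dots,x_m)$; ${\mathbf{x}_i}_{J_i}$ is the vector of the variables with (listed) indices in $J_i$, and $\mathbf{x}_J=({\mathbf{x}_1}_{J_1},{\mathbf{x}_2}_{J_2})$. The vector $\mathbf{c}=(\mathbf{c}_1,\mathbf{c}_2)$, $\mathbf{c}_i=(c_{i,1},\dots,c_{i,n_i})\in\mathbf{Z}_{p_i}^{n_i}$, has integer label $c=c_1+p_1^{n_1}c_2$ with $c_i=\sum_{j=1}^{n_i}c_{i,j}p_i^{j-1}$. The convention "$\pi=\pi_c$, $\pi'=\pi_c'$ whenever $\mathbf{x}_J=\mathbf{c}$" means that e.g. $x_{\pi(1)}$ denotes the function of $\mathbf{x}$ equal to $x_{\pi_c(1)}$ at points with $\mathbf{x}_J=\mathbf{c}$. Indexing of codes: $t=t_2p_1^{n_1+1}+t_1$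 with $0\le t_i<p_i^{n_i+1}$, and $t_i=\sum_{v=1}^{n_i+1}t_{i,v}p_i^{v-1}$, $t_{i,v}\in\mathbf{Z}_{p_i}$; $\mathbf{t}_i=(t_{i,1},\dots,t_{i,n_i})$, $\mathbf{d}_i=(d_{i,1},\dots,d_{i,n_i})$; $\cdot$ is the inner product. Sequence of a function: for $F:\mathbf{Z}_{p_1}^{m_1}\times\mathbf{Z}_{p_2}^{m_2}\to\mathbb{Z}_q$, $\psi(F)=(\xi_q^{F_0},\dots,\xi_q^{F_{L-1}})$, where $F_x=F(x_1,\dots,x_m)$ and $(x_1,\dots,x_m)\in\mathbf{Z}_{p_1}^{m_1}\times\mathbf{Z}_{p_2}^{m_2}$ is determined by $x=\sum_{j=1}^{m_1}x_jp_1^{j-1}+p_1^{m_1}\sum_{j=1}^{m_2}x_{m_1+j}p_2^{j-1}$. Aperiodic correlation: for complex sequences $\mathbf{a},\mathbf{b}$ of length $L$ and an integer $\tau$ with $|\tau|<L$, $\Theta(\mathbf{a},\mathbf{b})(\tau)=\sum_{s=0}^{L-\tau-1}a_s b_{s+\tau}^*$ if $0\le\tau<L$, and $\Theta(\mathbf{a},\mathbf{b})(\tau)=\sum_{s=0}^{L+\tau-1}a_{s-\tau}b_s^*$ if $-L<\tau<0$. A code is an ordered tuple of $M$ complex sequences of length $L$; for codes $\mathbf{C}=(\mathbf{c}^1,\dots,\mathbf{c}^M)$, $\mathbf{D}=(\mathbf{d}^1,\dots,\mathbf{d}^M)$ put $\Theta(\mathbf{C},\mathbf{D})(\tau)=\sum_{\ell=1}^M\Theta(\mathbf{c}^\ell,\mathbf{d}^\ell)(\tau)$.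 Here each code $\psi(C_t)$ is regarded as a tuple of sequences indexed by $(\mathbf{d}_1,d_{1,n_1+1},\mathbf{d}_2,d_{2,n_2+1})$, in the same order for all $t$. $(M,L)$-CCCs (complete complementary codes): a family of $M$ codes $\mathbf{C}_1,\dots,\mathbf{C}_M$, each consisting of $M$ sequences of length $L$, such that $\Theta(\mathbf{C}_{k_1},\mathbf{C}_{k_2})(\tau)=ML$ if $\tau=0$ and $k_1=k_2$; $=0$ if $0<|\tau|<L$ and $k_1=k_2$; and $=0$ if $|\tau|<L$ and $k_1\ne k_2$. *)

theory Defs
  imports Complex_Main "HOL-Library.FuncSet" "HOL-Computational_Algebra.Primes"
begin

text \<open>
  The ring of integers modulo \<open>q\<close> is represented by \<open>{..<q} :: nat set\<close>; sums and products are
  formed in \<open>nat\<close> and reduced with \<open>mod q\<close>. Vectors are extensional functions with 1-based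
  indices.
\<close>

definition Zvec :: "nat \<Rightarrow> nat \<Rightarrow> (nat \<Rightarrow> nat) set" where
  "Zvec p n = {1..n} \<rightarrow>\<^sub>E {..<p}"

definition box :: "nat \<Rightarrow> nat \<Rightarrow> nat \<Rightarrow> nat \<Rightarrow> (nat \<Rightarrow> nat) set" where
  "box p1 m1 p2 m2 = (\<Pi>\<^sub>E j\<in>{1..m1 + m2}. if j \<le> m1 then {..<p1} else {..<p2})"

definition permutes_mod :: "nat \<Rightarrow> (nat \<Rightarrow> nat) \<Rightarrow> bool" where
  "permutes_mod p \<phi> \<longleftrightarrow> bij_betw (\<lambda>u. \<phi> u mod p) {..<p} {..<p}"

text \<open>The function \<open>a\<close> lists the \<open>n\<close> indices of the variables that are selected.\<close>

definition subvec :: "(nat \<Rightarrow> nat) \<Rightarrow> nat \<Rightarrow> (nat \<Rightarrow> nat) \<Rightarrow> nat \<Rightarrow> nat" where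
  "subvec a n x = (\<lambda>i\<in>{1..n}. x (a i))"

definition undigits :: "nat \<Rightarrow> nat \<Rightarrow> (nat \<Rightarrow> nat) \<Rightarrow> nat" where
  "undigits p n v = (\<Sum>j=1..n. v j * p ^ (j - 1))"

definition label :: "nat \<Rightarrow> nat \<Rightarrow> nat \<Rightarrow> nat \<Rightarrow> (nat \<Rightarrow> nat) \<Rightarrow> (nat \<Rightarrow> nat) \<Rightarrow> nat" where
  "label p1 n1 p2 n2 c1 c2 = undigits p1 n1 c1 + p1 ^ n1 * undigits p2 n2 c2"

definition digit :: "nat \<Rightarrow> nat \<Rightarrow> nat \<Rightarrow> nat" where
  "digit p t v = (t div p ^ (v - 1)) mod p"

definition vec_of :: "nat \<Rightarrow> nat \<Rightarrow> nat \<Rightarrow> nat \<Rightarrow> nat \<Rightarrow> nat \<Rightarrow> nat" where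
  "vec_of p1 m1 p2 m2 s =
     (\<lambda>j\<in>{1..m1 + m2}. if j \<le> m1 then digit p1 s j else digit p2 (s div p1 ^ m1) (j - m1))"

lemma undigits_digit:
  assumes "t < p ^ n"
  shows "undigits p n (digit p t) = t"
proof -
  have "undigits p n (digit p t) = t mod p ^ n"
  proof (induction n)
    case 0
    then show ?case by (simp add: undigits_def)
  next
    case (Suc n)
    then show ?case
      by (simp add: undigits_def digit_def mod_mult2_eq mult.commute[of p])
  qed
  with assms show ?thesis by simp
qed

lemma digit_undigits:
  assumes "\<forall>j\<in>{1..n}. v j < p" "j \<in> {1..n}"
  shows "digit p (undigits p n v + p ^ n * r) j = v j"
  using assms
proof (induction n arbitrary: r)
  case 0
  then show ?case by simp
next
  case (Suc n)
  have p: "p > 0" using Suc.prems by fastforce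
  have split: "undigits p (Suc n) v + p ^ Suc n * r = undigits p n v + p ^ n * (v (Suc n) + p * r)"
    by (simp add: undigits_def algebra_simps)
  have bound: "undigits p k v < p ^ k" if "k \<le> n" for k
    using that
  proof (induction k)
    case 0
    then show ?case by (simp add: undigits_def)
  next
    case (Suc k)
    have "v (Suc k) + 1 \<le> p" using Suc.prems \<open>\<forall>j\<in>{1..Suc n}. v j < p\<close> by (simp add: Suc_leI)
    then have "(v (Suc k) + 1) * p ^ k \<le> p * p ^ k" by (rule mult_le_mono1)
    with Suc show ?case by (simp add: undigits_def algebra_simps)
  qed
  show ?case
  proof (cases "j = Suc n")
    case True
    then show ?thesis
      unfolding split using p bound[of n] Suc.prems by (simp add: digit_def)
  next
    case False
    then show ?thesis unfolding split using Suc by simp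
  qed
qed

text \<open>\<open>vec_of\<close> yields the unique point of the box with the given index.\<close>

lemma vec_of_unique:
  assumes p: "p1 > 0" "p2 > 0" and s: "s < p1 ^ m1 * p2 ^ m2"
  shows "x \<in> box p1 m1 p2 m2 \<and>
      s = (\<Sum>j=1..m1. x j * p1 ^ (j - 1)) + p1 ^ m1 * (\<Sum>j=1..m2. x (m1 + j) * p2 ^ (j - 1))
    \<longleftrightarrow> x = vec_of p1 m1 p2 m2 s" (is "?A x \<longleftrightarrow> _")
proof
  assume A: "?A x"
  define y where "y = (\<lambda>j. x (m1 + j))"
  have mem: "x j \<in> (if j \<le> m1 then {..<p1} else {..<p2})" if "j \<in> {1..m1 + m2}" for j
    by (rule PiE_mem[where T = "\<lambda>j. if j \<le> m1 then {..<p1} else {..<p2}", OF _ that])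
      (use A in \<open>unfold box_def, blast\<close>)
  have x: "\<forall>j\<in>{1..m1}. x j < p1"
  proof
    fix j assume "j \<in> {1..m1}"
    then show "x j < p1" using mem[of j] by simp
  qed
  have y: "\<forall>j\<in>{1..m2}. y j < p2"
  proof
    fix j assume "j \<in> {1..m2}"
    then show "y j < p2" using mem[of "m1 + j"] by (simp add: y_def)
  qed
  have s_eq: "s = undigits p1 m1 x + p1 ^ m1 * undigits p2 m2 y"
    using A by (simp add: undigits_def y_def)
  have d1: "digit p1 s j = x j" if "j \<in> {1..m1}" for j
    unfolding s_eq by (rule digit_undigits[OF x that])
  have "undigits p1 m1 x = undigits p1 m1 (digit p1 (s mod p1 ^ m1))"
    unfolding undigits_def
  proof (rule sum.cong[OF refl])
    fix j assume j: "j \<in> {1..m1}"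
    have "digit p1 (undigits p1 m1 (digit p1 (s mod p1 ^ m1)) + p1 ^ m1 * (s div p1 ^ m1)) j
        = digit p1 (s mod p1 ^ m1) j"
      by (rule digit_undigits[OF _ j]) (use p in \<open>simp add: digit_def\<close>)
    then have "digit p1 (s mod p1 ^ m1) j = digit p1 s j"
      using p by (simp add: undigits_digit)
    with d1[OF j] show "x j * p1 ^ (j - 1) = digit p1 (s mod p1 ^ m1) j * p1 ^ (j - 1)" by simp
  qed
  also have "\<dots> = s mod p1 ^ m1" using p by (simp add: undigits_digit)
  finally have "p1 ^ m1 * undigits p2 m2 y = p1 ^ m1 * (s div p1 ^ m1)"
    using s_eq mod_mult_div_eq[of s "p1 ^ m1"] by linarith
  then have div: "s div p1 ^ m1 = undigits p2 m2 y" using p by simp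
  have d2: "digit p2 (s div p1 ^ m1) j = y j" if "j \<in> {1..m2}" for j
    using digit_undigits[OF y that, of 0] div by simp
  have "x j = vec_of p1 m1 p2 m2 s j" for j
  proof (cases "j \<in> {1..m1 + m2}")
    case True
    show ?thesis
    proof (cases "j \<le> m1")
      case True
      with \<open>j \<in> {1..m1 + m2}\<close> show ?thesis using d1[of j] by (simp add: vec_of_def)
    next
      case False
      with \<open>j \<in> {1..m1 + m2}\<close> have "j - m1 \<in> {1..m2}" by auto
      from d2[OF this] False \<open>j \<in> {1..m1 + m2}\<close> show ?thesis by (simp add: vec_of_def y_def)
    qed
  next
    case False
    have "x \<in> extensional {1..m1 + m2}" using A unfolding box_def PiE_def by blast
    then have "x j = undefined" using False by (rule extensional_arb)
    moreover have "vec_of p1 m1 p2 m2 s j = undefined"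
      unfolding vec_of_def restrict_def using False by (rule if_not_P)
    ultimately show ?thesis by simp
  qed
  then show "x = vec_of p1 m1 p2 m2 s" by (rule ext)
next
  assume x: "x = vec_of p1 m1 p2 m2 s"
  have "(\<Sum>j=1..m1. x j * p1 ^ (j - 1)) = undigits p1 m1 (digit p1 (s mod p1 ^ m1))"
    unfolding undigits_def
  proof (rule sum.cong[OF refl])
    fix j assume j: "j \<in> {1..m1}"
    have "digit p1 (undigits p1 m1 (digit p1 (s mod p1 ^ m1)) + p1 ^ m1 * (s div p1 ^ m1)) j
        = digit p1 (s mod p1 ^ m1) j"
      by (rule digit_undigits[OF _ j]) (use p in \<open>simp add: digit_def\<close>)
    then have "digit p1 (s mod p1 ^ m1) j = digit p1 s j"
      using p by (simp add: undigits_digit)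
    with j show "x j * p1 ^ (j - 1) = digit p1 (s mod p1 ^ m1) j * p1 ^ (j - 1)"
      by (simp add: x vec_of_def)
  qed
  also have "\<dots> = s mod p1 ^ m1" using p by (simp add: undigits_digit)
  finally have 1: "(\<Sum>j=1..m1. x j * p1 ^ (j - 1)) = s mod p1 ^ m1" .
  have "(\<Sum>j=1..m2. x (m1 + j) * p2 ^ (j - 1)) = undigits p2 m2 (digit p2 (s div p1 ^ m1))"
    unfolding undigits_def by (rule sum.cong) (auto simp: x vec_of_def)
  also have "\<dots> = s div p1 ^ m1"
    by (rule undigits_digit) (use s p in \<open>simp add: less_mult_imp_div_less mult.commute\<close>)
  finally show "?A x"
    using 1 p by (auto simp: x vec_of_def box_def digit_def)
qed

definition \<xi> :: "nat \<Rightarrow> complex" where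
  "\<xi> q = exp (2 * of_real pi * \<i> / of_nat q)"

definition seq_of ::
  "nat \<Rightarrow> nat \<Rightarrow> nat \<Rightarrow> nat \<Rightarrow> nat \<Rightarrow> ((nat \<Rightarrow> nat) \<Rightarrow> nat) \<Rightarrow> nat \<Rightarrow> complex" where
  "seq_of q p1 m1 p2 m2 F s = \<xi> q ^ F (vec_of p1 m1 p2 m2 s)"

text \<open>Sequences of length \<open>L\<close> are functions of which only the values at \<open>{..<L}\<close> matter.\<close>

definition correlation :: "nat \<Rightarrow> (nat \<Rightarrow> complex) \<Rightarrow> (nat \<Rightarrow> complex) \<Rightarrow> int \<Rightarrow> complex" where
  "correlation L a b \<tau> =
     (if 0 \<le> \<tau> then (\<Sum>s<L - nat \<tau>. a s * cnj (b (s + nat \<tau>)))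
      else (\<Sum>s<L - nat (- \<tau>). a (s + nat (- \<tau>)) * cnj (b s)))"

text \<open>A code is a tuple of sequences, indexed by a finite set \<open>I\<close>.\<close>

definition code_correlation ::
  "'i set \<Rightarrow> nat \<Rightarrow> ('i \<Rightarrow> nat \<Rightarrow> complex) \<Rightarrow> ('i \<Rightarrow> nat \<Rightarrow> complex) \<Rightarrow> int \<Rightarrow> complex" where
  "code_correlation I L A B \<tau> = (\<Sum>l\<in>I. correlation L (A l) (B l) \<tau>)"

definition is_CCC :: "'i set \<Rightarrow> nat \<Rightarrow> nat \<Rightarrow> (nat \<Rightarrow> 'i \<Rightarrow> nat \<Rightarrow> complex) \<Rightarrow> bool" where
  "is_CCC I M L A \<longleftrightarrow>
     finite I \<and> card I = M \<and>
     (\<forall>k1<M. \<forall>k2<M. \<forall>\<tau>::int. \<bar>\<tau>\<bar> < int L \<longrightarrow>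
        code_correlation I L (A k1) (A k2) \<tau> =
          (if \<tau> = 0 \<and> k1 = k2 then of_nat (M * L) else 0))"

end

theory Submission imports Defs begin

text \<open>
  Replace each sequence by its spectrum \<open>\<theta> \<mapsto> \<Sum>\<^sub>s a\<^sub>s e\<^bsup>i\<theta>s\<^esup>\<close>. A family of \<open>M\<close> codes is a CCC exactly if, for every
  \<open>\<theta>\<close>, the \<open>M \<times> M\<close> matrix of spectra is \<open>\<surd>(M L)\<close> times a unitary matrix. Up to character tables on
  both sides, this matrix is block diagonal with one block for each \<open>\<^bold>c\<close>, namely
  \<open>(Q \<otimes> 1) \<Lambda> (1 \<otimes> P)\<close>, where the diagonal unitary matrix \<open>\<Lambda>\<close> comes from the term with \<open>\<lambda>\<close>, and \<open>Q\<close>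
  and \<open>P\<close> are products \<open>D\<^sub>1 H\<^sub>1 D\<^sub>2 \<dots> H\<^bsub>N-1\<^esub> D\<^sub>N\<close> along the paths given by \<open>\<pi>\<close> and \<open>\<pi>'\<close>: each \<open>D\<^sub>i\<close> is
  diagonal unitary and \<open>H\<^sub>i\<close> has the entries \<open>\<xi>\<^sub>p\<close> raised to \<open>f\<^sub>i(u) f\<^sub>i'(v)\<close>. Such an \<open>H\<^sub>i\<close> is a
  multiple of a unitary matrix exactly if \<open>f\<^sub>i\<close> and \<open>f\<^sub>i'\<close> permute modulo \<open>p\<close>. If all \<open>H\<^sub>i\<close> are, so is
  the whole product. Conversely, if the blocks are multiples of unitary matrices for all \<open>\<theta>\<close>, so are
  \<open>Q\<close> and \<open>P\<close>; the last factor \<open>H\<^bsub>N-1\<^esub>\<close> then is one too, because the Frobenius norm of the product of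
  the other factors, averaged over \<open>\<theta>\<close>, leaves no slack in the Cauchy-Schwarz inequality for
  \<open>H\<^bsub>N-1\<^esub>\<close> and its inverse, and induction gives the remaining factors.
\<close>

section \<open>Matrices with orthogonal rows\<close>

text \<open>This is \<open>M M\<^sup>* = s 1\<close>. Rows and columns have separate index sets
  because codes are numbered by \<open>t\<close>, their sequences by tuples \<open>d\<close>. The
  scale \<open>s\<close> stays a parameter: in the converse direction the factors are multiples of
  unitary matrices by unknown scalars.\<close>

definition orth_rows :: "'a set \<Rightarrow> 'b set \<Rightarrow> complex \<Rightarrow> ('a \<Rightarrow> 'b \<Rightarrow> complex) \<Rightarrow> bool" where
  "orth_rows A B s M \<longleftrightarrow>
     (\<forall>i\<in>A. \<forall>j\<in>A. (\<Sum>k\<in>B. M i k * cnj (M j k)) = (if i = j then s else 0))"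

lemma orth_rowsI:
  "(\<And>i j. i \<in> A \<Longrightarrow> j \<in> A \<Longrightarrow> (\<Sum>k\<in>B. M i k * cnj (M j k)) = (if i = j then s else 0))
    \<Longrightarrow> orth_rows A B s M"
  by (simp add: orth_rows_def)

lemma orth_rowsD:
  "orth_rows A B s M \<Longrightarrow> i \<in> A \<Longrightarrow> j \<in> A \<Longrightarrow>
    (\<Sum>k\<in>B. M i k * cnj (M j k)) = (if i = j then s else 0)"
  by (simp add: orth_rows_def)

lemma orth_rows_Times:
  "orth_rows (A \<times> B) (C \<times> D) s M \<longleftrightarrow>
    (\<forall>i\<in>A. \<forall>i'\<in>B. \<forall>j\<in>A. \<forall>j'\<in>B.
      (\<Sum>k\<in>C. \<Sum>l\<in>D. M (i, i') (k, l) * cnj (M (j, j') (k, l))) =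
        (if i = j \<and> i' = j' then s else 0))"
  unfolding orth_rows_def by (simp add: sum.cartesian_product case_prod_unfold)

lemma orth_rows_cong:
  assumes "\<And>i k. i \<in> A \<Longrightarrow> k \<in> B \<Longrightarrow> M i k = N i k"
  shows "orth_rows A B s M \<longleftrightarrow> orth_rows A B s N"
  unfolding orth_rows_def using assms by (intro ball_cong refl) simp

lemma orth_rows_cnj:
  assumes "orth_rows A B (of_real s) M"
  shows "orth_rows A B (of_real s) (\<lambda>i k. cnj (M i k))"
proof (rule orth_rowsI)
  fix i j assume "i \<in> A" "j \<in> A"
  from orth_rowsD[OF assms this(2,1)]
  show "(\<Sum>k\<in>B. cnj (M i k) * cnj (cnj (M j k))) = (if i = j then of_real s else 0)"
    by (simp add: mult.commute)
qed

lemma orth_rows_real: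
  assumes "orth_rows A B s M" "i \<in> A"
  shows "s = of_real (\<Sum>k\<in>B. (cmod (M i k))\<^sup>2)"
  using orth_rowsD[OF assms(1) assms(2) assms(2)] by (simp add: complex_norm_square del: of_real_power)

lemma orth_rows_mult:
  assumes "orth_rows A B r M" "orth_rows B C s N" and fin: "finite B"
  shows "orth_rows A C (r * s) (\<lambda>i k. \<Sum>j\<in>B. M i j * N j k)"
proof (rule orth_rowsI)
  fix i i' assume i: "i \<in> A" "i' \<in> A"
  have "(\<Sum>k\<in>C. (\<Sum>j\<in>B. M i j * N j k) * cnj (\<Sum>j\<in>B. M i' j * N j k))
      = (\<Sum>k\<in>C. \<Sum>j\<in>B. \<Sum>l\<in>B. (M i j * cnj (M i' l)) * (N j k * cnj (N l k)))"
    by (simp add: sum_product ac_simps)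
  also have "\<dots> = (\<Sum>j\<in>B. \<Sum>l\<in>B. (M i j * cnj (M i' l)) * (\<Sum>k\<in>C. N j k * cnj (N l k)))"
    by (subst sum.swap, rule sum.cong[OF refl], subst sum.swap) (simp add: sum_distrib_left)
  also have "\<dots> = (\<Sum>j\<in>B. \<Sum>l\<in>B. (M i j * cnj (M i' l)) * (if j = l then s else 0))"
    by (intro sum.cong refl arg_cong2[where f="(*)"] orth_rowsD[OF assms(2)])
  also have "\<dots> = (\<Sum>j\<in>B. M i j * cnj (M i' j)) * s"
    using fin by (simp add: if_distrib sum.delta sum_distrib_right cong: if_cong)
  finally show "(\<Sum>k\<in>C. (\<Sum>j\<in>B. M i j * N j k) * cnj (\<Sum>j\<in>B. M i' j * N j k))
      = (if i = i' then r * s else 0)"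
    using orth_rowsD[OF assms(1) i] by simp
qed

text \<open>With \<open>E = M\<^sup>* M / s\<close>, the squared Frobenius norm of \<open>1 - E\<close> is
  \<open>card B - 2 tr E + tr (E E\<^sup>*) = card B - card A\<close>.\<close>

lemma orth_rows_transpose:
  assumes M: "orth_rows A B s M" and s: "s \<noteq> 0"
    and fin: "finite A" "finite B" and card: "card A = card B"
  shows "orth_rows B A s (\<lambda>k i. M i k)"
proof (cases "A = {}")
  case True
  then show ?thesis using card fin by (simp add: orth_rows_def)
next
  case False
  then obtain i0 where i0: "i0 \<in> A" by blast
  define r where "r = (\<Sum>k\<in>B. (cmod (M i0 k))\<^sup>2)"
  have sr: "s = of_real r" using orth_rows_real[OF M i0] by (simp add: r_def)
  \<comment> \<open>This is the transpose of \<open>M\<^sup>* M\<close>, not yet divided by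
    \<open>s\<close>, so the squared Frobenius norm of \<open>D\<close> below is
    \<open>s\<^sup>2\<close> times \<open>card B - card A\<close>.\<close>
  define E where "E k l = (\<Sum>i\<in>A. M i k * cnj (M i l))" for k l
  have trE: "(\<Sum>k\<in>B. E k k) = of_nat (card A) * s"
    unfolding E_def by (subst sum.swap) (simp add: orth_rowsD[OF M])
  have "(\<Sum>k\<in>B. \<Sum>l\<in>B. E k l * cnj (E k l))
      = (\<Sum>k\<in>B. \<Sum>l\<in>B. \<Sum>i\<in>A. \<Sum>j\<in>A. (M i k * cnj (M j k)) * (M j l * cnj (M i l)))"
    by (simp add: E_def sum_product ac_simps)
  also have "\<dots> = (\<Sum>k\<in>B. \<Sum>i\<in>A. \<Sum>j\<in>A. (M i k * cnj (M j k)) * (\<Sum>l\<in>B. M j l * cnj (M i l)))"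
    by (rule sum.cong[OF refl], subst sum.swap, rule sum.cong[OF refl], subst sum.swap)
      (simp add: sum_distrib_left)
  also have "\<dots> = (\<Sum>k\<in>B. \<Sum>i\<in>A. \<Sum>j\<in>A. (M i k * cnj (M j k)) * (if j = i then s else 0))"
    by (intro sum.cong refl arg_cong2[where f="(*)"] orth_rowsD[OF M])
  also have "\<dots> = (\<Sum>k\<in>B. \<Sum>i\<in>A. M i k * cnj (M i k) * s)"
    using fin by (simp add: if_distrib sum.delta cong: if_cong)
  also have "\<dots> = of_nat (card A) * s * s"
    by (subst sum.swap) (simp add: orth_rowsD[OF M] flip: sum_distrib_right)
  finally have EE: "(\<Sum>k\<in>B. \<Sum>l\<in>B. E k l * cnj (E k l)) = of_nat (card A) * s * s" .
  define D where "D k l = E k l - (if k = l then s else 0)" for k l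
  \<comment> \<open>Cross terms in the expansion of \<open>D\<close> occur only for
    \<open>k = l\<close>, so it is enough that the diagonal of \<open>E\<close> is real.\<close>
  have Ekk: "cnj (E k k) = E k k" for k by (simp add: E_def mult.commute)
  have "(\<Sum>k\<in>B. \<Sum>l\<in>B. D k l * cnj (D k l))
      = (\<Sum>k\<in>B. \<Sum>l\<in>B. E k l * cnj (E k l) + (if k = l then s * s - 2 * s * E k k else 0))"
    by (intro sum.cong refl) (simp add: D_def sr algebra_simps Ekk)
  also have "\<dots> = of_nat (card A) * s * s + (\<Sum>k\<in>B. s * s - 2 * s * E k k)"
    using fin by (simp add: sum.distrib EE)
  also have "\<dots> = 0"
    using trE card by (simp add: sum_subtractf flip: sum_distrib_left)
  finally have "complex_of_real (\<Sum>k\<in>B. \<Sum>l\<in>B. (cmod (D k l))\<^sup>2) = 0"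
    by (simp add: complex_norm_square del: of_real_power)
  then have "(\<Sum>k\<in>B. \<Sum>l\<in>B. (cmod (D k l))\<^sup>2) = 0" by (simp only: of_real_eq_0_iff)
  then have "D k l = 0" if "k \<in> B" "l \<in> B" for k l
    using that fin by (simp add: sum_nonneg_eq_0_iff sum_nonneg)
  then show ?thesis by (intro orth_rowsI) (simp add: D_def E_def)
qed

text \<open>As \<open>M\<close> is square, also \<open>M\<^sup>* M = r 1\<close>, so multiplying the
  product by \<open>M\<^sup>*\<close> from the left returns \<open>r N\<close>. Its Gram matrix is
  \<open>r s 1\<close>, and dividing by \<open>r\<^sup>2\<close> leaves
  \<open>s / r\<close>.\<close>

lemma orth_rows_cancel_left:
  assumes MN: "orth_rows A C s (\<lambda>i k. \<Sum>j\<in>B. M i j * N j k)"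
    and M: "orth_rows A B r M" and r: "r \<noteq> 0"
    and fin: "finite A" "finite B" and card: "card A = card B" and ne: "A \<noteq> {}"
  shows "orth_rows B C (s / r) N"
proof -
  have MT: "orth_rows B A r (\<lambda>j i. M i j)"
    using orth_rows_transpose[OF M r fin card] .
  obtain i0 where "i0 \<in> A" using ne by blast
  then obtain r' where r': "r = of_real r'" using orth_rows_real[OF M] by blast
  have MT': "orth_rows B A r (\<lambda>j i. cnj (M i j))"
    using orth_rows_cnj[of B A r'] MT r' by blast
  have "orth_rows B C (r * s) (\<lambda>j k. \<Sum>i\<in>A. cnj (M i j) * (\<Sum>l\<in>B. M i l * N l k))"
    by (rule orth_rows_mult[OF MT' MN fin(1)])
  moreover have "(\<Sum>i\<in>A. cnj (M i j) * (\<Sum>l\<in>B. M i l * N l k)) = r * N j k"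
    if "j \<in> B" for j k
  proof -
    have "(\<Sum>i\<in>A. cnj (M i j) * (\<Sum>l\<in>B. M i l * N l k))
        = (\<Sum>l\<in>B. (\<Sum>i\<in>A. M i l * cnj (M i j)) * N l k)"
      unfolding sum_distrib_left sum_distrib_right
      by (subst sum.swap) (simp add: ac_simps)
    also have "\<dots> = (\<Sum>l\<in>B. (if l = j then r else 0) * N l k)"
      by (intro sum.cong refl arg_cong2[where f="(*)"] orth_rowsD[OF MT] that)
    also have "\<dots> = r * N j k"
      using fin that by (simp add: if_distribR if_distrib sum.delta cong: if_cong)
    finally show ?thesis .
  qed
  ultimately have "orth_rows B C (r * s) (\<lambda>j k. r * N j k)"
    by (subst (asm) orth_rows_cong[where N="\<lambda>j k. r * N j k"])
  then have "(\<Sum>k\<in>C. r * N i k * cnj (r * N j k)) = (if i = j then r * s else 0)"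
    if "i \<in> B" "j \<in> B" for i j using that by (rule orth_rowsD)
  moreover have "(\<Sum>k\<in>C. r * N i k * cnj (r * N j k)) = r * r * (\<Sum>k\<in>C. N i k * cnj (N j k))" for i j
    by (simp add: r' sum_distrib_left ac_simps)
  ultimately have *: "r * r * (\<Sum>k\<in>C. N i k * cnj (N j k)) = (if i = j then r * s else 0)"
    if "i \<in> B" "j \<in> B" for i j using that by metis
  show ?thesis
  proof (rule orth_rowsI)
    fix i j assume "i \<in> B" "j \<in> B"
    from *[OF this] r show "(\<Sum>k\<in>C. N i k * cnj (N j k)) = (if i = j then s / r else 0)"
      by (auto simp: field_simps split: if_splits)
  qed
qed

text \<open>Transposition makes \<open>N\<close> the left factor; it applies to each matrix here
  because \<open>A\<close>, \<open>B\<close> and \<open>C\<close> have the same cardinality.\<close>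

lemma orth_rows_cancel_right:
  assumes MN: "orth_rows A C s (\<lambda>i k. \<Sum>j\<in>B. M i j * N j k)"
    and N: "orth_rows B C r N" and nz: "s \<noteq> 0" "r \<noteq> 0"
    and fin: "finite A" "finite B" "finite C"
    and card: "card A = card C" "card B = card C" and ne: "C \<noteq> {}"
  shows "orth_rows A B (s / r) M"
proof -
  have "orth_rows C A s (\<lambda>k i. \<Sum>j\<in>B. N j k * M i j)"
    using orth_rows_transpose[OF MN nz(1) fin(1,3) card(1)] by (simp add: mult.commute)
  from orth_rows_cancel_left[OF this orth_rows_transpose[OF N nz(2) fin(2,3) card(2)] nz(2)
      fin(3,2) card(2)[symmetric] ne]
  have "orth_rows B A (s / r) (\<lambda>j i. M i j)" .
  from orth_rows_transpose[OF this _ fin(2,1)] show ?thesis using nz card by simp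
qed

lemma orth_rows_scale:
  assumes "\<And>k. k \<in> B \<Longrightarrow> cmod (w k) = 1"
  shows "orth_rows A B s (\<lambda>i k. M i k * w k) \<longleftrightarrow> orth_rows A B s M"
proof -
  have "M i k * w k * cnj (M j k * w k) = M i k * cnj (M j k)" if "k \<in> B" for i j k
  proof -
    have "w k * cnj (w k) = 1" using assms[OF that] by (simp add: complex_norm_square[symmetric])
    then show ?thesis by (simp add: ac_simps)
  qed
  then have "(\<Sum>k\<in>B. M i k * w k * cnj (M j k * w k)) = (\<Sum>k\<in>B. M i k * cnj (M j k))" for i j
    by (intro sum.cong refl)
  then show ?thesis by (simp only: orth_rows_def)
qed

text \<open>Parseval: the vector \<open>c\<close> is a matrix with the single row index
  \<open>()\<close>, so this is the only entry of the Gram matrix in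
  \<open>orth_rows_mult\<close>.\<close>

lemma orth_rows_norm:
  assumes M: "orth_rows A B (of_real s) M" and fin: "finite A"
  shows "(\<Sum>k\<in>B. (cmod (\<Sum>i\<in>A. c i * M i k))\<^sup>2) = s * (\<Sum>i\<in>A. (cmod (c i))\<^sup>2)"
proof -
  have c: "orth_rows {()} A (\<Sum>i\<in>A. c i * cnj (c i)) (\<lambda>_. c)"
    by (simp add: orth_rows_def)
  from orth_rowsD[OF orth_rows_mult[OF c M fin], of "()" "()"]
  have "complex_of_real (\<Sum>k\<in>B. (cmod (\<Sum>i\<in>A. c i * M i k))\<^sup>2)
      = complex_of_real (s * (\<Sum>i\<in>A. (cmod (c i))\<^sup>2))"
    by (simp add: complex_norm_square mult.commute del: of_real_power)
  then show ?thesis by (simp only: of_real_eq_iff)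
qed

text \<open>\<open>B = X\<^sup>* Y / s\<close> is the inverse of \<open>A\<close>; its Frobenius norm is at most \<open>1\<close>, while the unit
  entries of \<open>A\<close> force every row of \<open>B\<close> to have squared norm at least \<open>1 / card S\<close>. The equality
  case of the Cauchy-Schwarz inequality gives \<open>B = A\<^sup>* / card S\<close>.\<close>

lemma orth_rows_factor:
  fixes A X Y :: "'a \<Rightarrow> 'a \<Rightarrow> complex"
  assumes X: "orth_rows S S (of_real s) (\<lambda>u b. \<Sum>a\<in>S. Y u a * A a b)" and s: "s > 0"
    and fin: "finite S"
    and A: "\<And>a b. a \<in> S \<Longrightarrow> b \<in> S \<Longrightarrow> cmod (A a b) = 1"
    and Y: "(\<Sum>u\<in>S. \<Sum>a\<in>S. (cmod (Y u a))\<^sup>2) \<le> s"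
  shows "orth_rows S S (of_nat (card S)) A"
proof (cases "S = {}")
  case True
  then show ?thesis by (simp add: orth_rows_def)
next
  case False
  define p where "p = real (card S)"
  have p: "p > 0" using False fin by (simp add: p_def card_gt_0_iff)
  define X where "X u b = (\<Sum>a\<in>S. Y u a * A a b)" for u b
  have oX: "orth_rows S S (of_real s) X" using X by (simp add: X_def[abs_def])
  have oXT: "orth_rows S S (of_real s) (\<lambda>b u. X u b)"
    using s fin by (intro orth_rows_transpose[OF oX]) auto
  define B where "B b a = (\<Sum>u\<in>S. Y u a * cnj (X u b)) / of_real s" for b a
  have BA: "(\<Sum>a\<in>S. B b a * A a b') = (if b = b' then 1 else 0)" if "b \<in> S" "b' \<in> S" for b b'
  proof -
    have "(\<Sum>a\<in>S. B b a * A a b') = (\<Sum>a\<in>S. \<Sum>u\<in>S. Y u a * cnj (X u b) * A a b') / of_real s"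
      by (simp add: B_def sum_divide_distrib sum_distrib_right)
    also have "(\<Sum>a\<in>S. \<Sum>u\<in>S. Y u a * cnj (X u b) * A a b') = (\<Sum>u\<in>S. X u b' * cnj (X u b))"
      by (subst sum.swap) (simp add: X_def sum_distrib_right ac_simps)
    also have "\<dots> = (if b' = b then of_real s else 0)" using oXT that by (intro orth_rowsD)
    finally show ?thesis using s by auto
  qed
  \<comment> \<open>\<open>X\<close> is \<open>sqrt s\<close> times a unitary matrix, so column
    \<open>a\<close> of \<open>B\<close> has the squared norm of column \<open>a\<close> of
    \<open>Y\<close>, divided by \<open>s\<close>. Summed over \<open>a\<close>, the bound on
    \<open>Y\<close> says that the squared Frobenius norm of \<open>B\<close> is at most 1.\<close>
  have "(\<Sum>b\<in>S. (cmod (B b a))\<^sup>2) = (\<Sum>u\<in>S. (cmod (Y u a))\<^sup>2) / s" for a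
  proof -
    have "(\<Sum>b\<in>S. (cmod (B b a))\<^sup>2) = (\<Sum>b\<in>S. (cmod (\<Sum>u\<in>S. Y u a * cnj (X u b)))\<^sup>2) / s\<^sup>2"
      unfolding B_def by (simp add: norm_divide power_divide flip: sum_divide_distrib)
    also have "\<dots> = (\<Sum>u\<in>S. (cmod (Y u a))\<^sup>2) / s"
      using s by (subst orth_rows_norm[OF orth_rows_cnj[OF oX] fin]) (simp add: power2_eq_square)
    finally show ?thesis .
  qed
  then have "(\<Sum>b\<in>S. \<Sum>a\<in>S. (cmod (B b a))\<^sup>2) = (\<Sum>a\<in>S. (\<Sum>u\<in>S. (cmod (Y u a))\<^sup>2) / s)"
    by (subst sum.swap) simp
  also have "\<dots> = (\<Sum>u\<in>S. \<Sum>a\<in>S. (cmod (Y u a))\<^sup>2) / s"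
    by (subst sum.swap) (simp add: sum_divide_distrib)
  finally have B1: "(\<Sum>b\<in>S. \<Sum>a\<in>S. (cmod (B b a))\<^sup>2) \<le> 1" using Y s by simp
  \<comment> \<open>The deviation from the expected inverse. In row \<open>b\<close> the cross terms
    add up to \<open>- 2 / p\<close> because \<open>B A = 1\<close>, and the unit entries of
    \<open>A\<close> contribute \<open>1 / p\<close>; over all \<open>p\<close> rows the net change
    is \<open>- 1\<close>.\<close>
  define D where "D b a = B b a - cnj (A a b) / of_real p" for b a
  have D: "(\<Sum>a\<in>S. (cmod (D b a))\<^sup>2) = (\<Sum>a\<in>S. (cmod (B b a))\<^sup>2) - 1 / p" if b: "b \<in> S" for b
  proof -
    have "(cmod (D b a))\<^sup>2 = (cmod (B b a))\<^sup>2 - 2 / p * Re (B b a * A a b) + 1 / p\<^sup>2"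
      if a: "a \<in> S" for a
    proof -
      have "(cmod (A a b))\<^sup>2 = 1" using A a b by simp
      then have "(Re (A a b))\<^sup>2 + (Im (A a b))\<^sup>2 = 1" by (simp add: cmod_power2)
      then have *: "(Re (A a b))\<^sup>2 / p\<^sup>2 + (Im (A a b))\<^sup>2 / p\<^sup>2 = 1 / p\<^sup>2"
        by (simp flip: add_divide_distrib)
      have ReD: "Re (D b a) = Re (B b a) - Re (A a b) / p"
        and ImD: "Im (D b a) = Im (B b a) + Im (A a b) / p" by (simp_all add: D_def)
      show ?thesis unfolding *[symmetric] cmod_power2 ReD ImD
        using p by (simp add: power2_eq_square field_simps)
    qed
    then have "(\<Sum>a\<in>S. (cmod (D b a))\<^sup>2)
        = (\<Sum>a\<in>S. (cmod (B b a))\<^sup>2) - 2 / p * Re (\<Sum>a\<in>S. B b a * A a b) + (\<Sum>a\<in>S. 1 / p\<^sup>2)"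
      by (simp only: sum.distrib sum_subtractf Re_sum sum_distrib_left cong: sum.cong)
    then show ?thesis using p BA[OF b b] by (simp add: p_def power2_eq_square)
  qed
  have "(\<Sum>b\<in>S. \<Sum>a\<in>S. (cmod (D b a))\<^sup>2) = (\<Sum>b\<in>S. \<Sum>a\<in>S. (cmod (B b a))\<^sup>2) - 1"
    using p by (simp add: D sum_subtractf p_def)
  with B1 have "(\<Sum>b\<in>S. \<Sum>a\<in>S. (cmod (D b a))\<^sup>2) \<le> 0" by simp
  moreover have "(\<Sum>b\<in>S. \<Sum>a\<in>S. (cmod (D b a))\<^sup>2) \<ge> 0"
    by (intro sum_nonneg zero_le_power2)
  ultimately have "(\<Sum>b\<in>S. \<Sum>a\<in>S. (cmod (D b a))\<^sup>2) = 0" by linarith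
  then have "D b a = 0" if "b \<in> S" "a \<in> S" for a b
    using that fin by (simp add: sum_nonneg_eq_0_iff sum_nonneg)
  then have B: "B b a = cnj (A a b) / of_real p" if "b \<in> S" "a \<in> S" for a b
    using that by (simp add: D_def)
  \<comment> \<open>With the formula for \<open>B\<close>, the identity \<open>B A = 1\<close>
    states orthogonality of the columns of \<open>A\<close>; transposition passes to the
    rows.\<close>
  have "orth_rows S S (of_real p) (\<lambda>b a. A a b)"
  proof (rule orth_rowsI)
    fix b b' assume b: "b \<in> S" "b' \<in> S"
    have "(\<Sum>a\<in>S. A a b * cnj (A a b')) = of_real p * (\<Sum>a\<in>S. B b' a * A a b)"
      using p b by (simp add: B sum_distrib_left mult.commute)
    also have "\<dots> = (if b = b' then of_real p else 0)" using BA[of b' b] b by auto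
    finally show "(\<Sum>a\<in>S. A a b * cnj (A a b')) = (if b = b' then of_real p else 0)" .
  qed
  from orth_rows_transpose[OF this _ fin fin refl] show ?thesis using p by (simp add: p_def)
qed

section \<open>Tensor products and block diagonal matrices\<close>

lemma orth_rows_tensor:
  assumes Q: "orth_rows A A r Q" and P: "orth_rows B B s P"
    and l: "\<And>a b. a \<in> A \<Longrightarrow> b \<in> B \<Longrightarrow> cmod (l a b) = 1"
  shows "orth_rows (A \<times> B) (A \<times> B) (r * s) (\<lambda>(u, v) (a, b). Q u a * l a v * P v b)"
  unfolding orth_rows_Times prod.case
proof (intro ballI)
  fix u v u' v' assume *: "u \<in> A" "v \<in> B" "u' \<in> A" "v' \<in> B"
  have l1: "l a b * cnj (l a b) = 1" if "a \<in> A" "b \<in> B" for a b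
    using l[OF that] by (simp add: complex_norm_square[symmetric])
  \<comment> \<open>The phase depends only on the column of \<open>Q\<close> and the row of
    \<open>P\<close>. Summing over \<open>b\<close> first therefore leaves only
    \<open>v = v'\<close>, where the phases cancel before the sum over \<open>a\<close> is
    taken.\<close>
  have "(\<Sum>a\<in>A. \<Sum>b\<in>B. Q u a * l a v * P v b * cnj (Q u' a * l a v' * P v' b))
      = (\<Sum>a\<in>A. (Q u a * cnj (Q u' a)) * (l a v * cnj (l a v')) * (\<Sum>b\<in>B. P v b * cnj (P v' b)))"
    by (simp add: sum_distrib_left ac_simps)
  also have "\<dots> = (\<Sum>a\<in>A. Q u a * cnj (Q u' a)) * (if v = v' then s else 0)"
    using * by (auto simp: l1 sum_distrib_right orth_rowsD[OF P])
  also have "\<dots> = (if u = u' \<and> v = v' then r * s else 0)"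
    by (simp add: orth_rowsD[OF Q] *)
  finally show "(\<Sum>a\<in>A. \<Sum>b\<in>B. Q u a * l a v * P v b * cnj (Q u' a * l a v' * P v' b))
      = (if u = u' \<and> v = v' then r * s else 0)" .
qed

text \<open>Between rows with the same \<open>v\<close> the phases cancel, and the inner product is
  that of the rows of \<open>Q\<close> times the squared norm \<open>c\<close> of row
  \<open>v\<close> of \<open>P\<close>. Since \<open>s\<close> is nonzero, so is
  \<open>c\<close>.\<close>

lemma orth_rows_tensor_left:
  assumes K: "orth_rows (A \<times> B) (A \<times> B) s (\<lambda>(u, v) (a, b). Q u a * l a v * P v b)"
    and s: "s \<noteq> 0" and ne: "A \<noteq> {}" "B \<noteq> {}"
    and l: "\<And>a b. a \<in> A \<Longrightarrow> b \<in> B \<Longrightarrow> cmod (l a b) = 1"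
  shows "\<exists>r. r \<noteq> 0 \<and> orth_rows A A r Q"
proof -
  obtain v u0 where v: "v \<in> B" and u0: "u0 \<in> A" using ne by blast
  define c where "c = (\<Sum>b\<in>B. P v b * cnj (P v b))"
  have l1: "l a b * cnj (l a b) = 1" if "a \<in> A" "b \<in> B" for a b
    using l[OF that] by (simp add: complex_norm_square[symmetric])
  have *: "(\<Sum>a\<in>A. Q u a * cnj (Q u' a)) * c = (if u = u' then s else 0)"
    if "u \<in> A" "u' \<in> A" for u u'
  proof -
    have "(\<Sum>a\<in>A. Q u a * cnj (Q u' a)) * c
        = (\<Sum>a\<in>A. \<Sum>b\<in>B. (l a v * cnj (l a v)) * (Q u a * cnj (Q u' a) * (P v b * cnj (P v b))))"
      using v by (simp add: c_def l1 sum_product)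
    also have "\<dots> = (\<Sum>a\<in>A. \<Sum>b\<in>B. Q u a * l a v * P v b * cnj (Q u' a * l a v * P v b))"
      by (simp add: ac_simps)
    also have "\<dots> = (if u = u' \<and> v = v then s else 0)"
      using K that v unfolding orth_rows_Times prod.case by blast
    finally show ?thesis by simp
  qed
  have c: "c \<noteq> 0" using *[OF u0 u0] s by auto
  have "orth_rows A A (s / c) Q"
  proof (rule orth_rowsI)
    fix i j assume "i \<in> A" "j \<in> A"
    from *[OF this] c show "(\<Sum>a\<in>A. Q i a * cnj (Q j a)) = (if i = j then s / c else 0)"
      by (auto simp: field_simps split: if_splits)
  qed
  then show ?thesis using c s by (intro exI[of _ "s / c"]) auto
qed

text \<open>The transposed matrix, with the two coordinates exchanged, again has this shape, now
  with the transpose of \<open>P\<close> as its first factor; so the left case applies.\<close>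

lemma orth_rows_tensor_right:
  assumes K: "orth_rows (A \<times> B) (A \<times> B) s (\<lambda>(u, v) (a, b). Q u a * l a v * P v b)"
    and s: "s \<noteq> 0" and fin: "finite A" "finite B" and ne: "A \<noteq> {}" "B \<noteq> {}"
    and l: "\<And>a b. a \<in> A \<Longrightarrow> b \<in> B \<Longrightarrow> cmod (l a b) = 1"
  shows "\<exists>r. r \<noteq> 0 \<and> orth_rows B B r P"
proof -
  have "orth_rows (A \<times> B) (A \<times> B) s (\<lambda>k i. (case i of (u, v) \<Rightarrow> \<lambda>(a, b). Q u a * l a v * P v b) k)"
    using orth_rows_transpose[OF K s] fin by simp
  then have *: "(\<Sum>u\<in>A. \<Sum>v\<in>B. Q u a * l a v * P v b * cnj (Q u a' * l a' v * P v b'))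
      = (if a = a' \<and> b = b' then s else 0)" if "a \<in> A" "b \<in> B" "a' \<in> A" "b' \<in> B" for a b a' b'
    using that unfolding orth_rows_Times prod.case by blast
  have "orth_rows (B \<times> A) (B \<times> A) s (\<lambda>(b, a) (v, u). P v b * l a v * Q u a)"
    unfolding orth_rows_Times prod.case
  proof (intro ballI)
    fix b a b' a' assume "b \<in> B" "a \<in> A" "b' \<in> B" "a' \<in> A"
    from *[OF this(2,1,4,3)]
    show "(\<Sum>v\<in>B. \<Sum>u\<in>A. P v b * l a v * Q u a * cnj (P v b' * l a' v * Q u a'))
        = (if b = b' \<and> a = a' then s else 0)"
      by (subst sum.swap) (simp add: ac_simps conj_commute)
  qed
  from orth_rows_tensor_left[OF this s ne(2,1)] l
  obtain r where r: "r \<noteq> 0" "orth_rows B B r (\<lambda>b v. P v b)" by blast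
  from orth_rows_transpose[OF r(2,1) fin(2,2) refl] r(1) show ?thesis by blast
qed

lemma orth_rows_reindex:
  assumes "orth_rows A B s M" "inj_on h T" "h ` T \<subseteq> A"
  shows "orth_rows T B s (\<lambda>i. M (h i))"
proof (rule orth_rowsI)
  fix i j assume "i \<in> T" "j \<in> T"
  moreover from this have "h i \<in> A" "h j \<in> A" using assms(3) by auto
  ultimately show "(\<Sum>k\<in>B. M (h i) k * cnj (M (h j) k)) = (if i = j then s else 0)"
    using orth_rowsD[OF assms(1), of "h i" "h j"] inj_on_eq_iff[OF assms(2)] by simp
qed

lemma orth_rows_prod:
  assumes "orth_rows A B r M" "orth_rows C D s N"
  shows "orth_rows (A \<times> C) (B \<times> D) (r * s) (\<lambda>(i, i') (k, k'). M i k * N i' k')"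
  unfolding orth_rows_Times prod.case
proof (intro ballI)
  fix i i' j j' assume *: "i \<in> A" "i' \<in> C" "j \<in> A" "j' \<in> C"
  have "(\<Sum>k\<in>B. \<Sum>l\<in>D. M i k * N i' l * cnj (M j k * N j' l))
      = (\<Sum>k\<in>B. M i k * cnj (M j k)) * (\<Sum>l\<in>D. N i' l * cnj (N j' l))"
    by (simp add: sum_product ac_simps)
  then show "(\<Sum>k\<in>B. \<Sum>l\<in>D. M i k * N i' l * cnj (M j k * N j' l))
      = (if i = j \<and> i' = j' then r * s else 0)"
    using * by (simp add: orth_rowsD[OF assms(1)] orth_rowsD[OF assms(2)])
qed

lemma sum_if_const: "(\<Sum>x\<in>A. if P then f x else 0) = (if P then \<Sum>x\<in>A. f x else 0)"
  by simp

text \<open>The labels \<open>(c1, c2)\<close> of the blocks are interleaved with the other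
  coordinates to match the index tuples of the codes. Rows with different labels have disjoint
  supports, and inside a block the phase \<kappa> cancels.\<close>

lemma orth_rows_block:
  assumes fin: "finite C1" "finite C2"
    and \<kappa>: "\<And>c1 c2. cmod (\<kappa> c1 c2) = 1"
  shows "orth_rows (C1 \<times> A \<times> C2 \<times> B) (C1 \<times> A \<times> C2 \<times> B) s
      (\<lambda>(c1, u, c2, v) (b1, a, b2, b). if c1 = b1 \<and> c2 = b2 then \<kappa> c1 c2 * K c1 c2 (u, v) (a, b) else 0)
    \<longleftrightarrow> (\<forall>c1\<in>C1. \<forall>c2\<in>C2. orth_rows (A \<times> B) (A \<times> B) s (K c1 c2))"
    (is "orth_rows ?I ?I s ?M \<longleftrightarrow> _")
proof -
  have *: "(\<Sum>k\<in>?I. ?M (c1, u, c2, v) k * cnj (?M (c1', u', c2', v') k))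
      = (if c1 = c1' \<and> c2 = c2' then \<Sum>k\<in>A \<times> B. K c1 c2 (u, v) k * cnj (K c1 c2 (u', v') k) else 0)"
    if "c1 \<in> C1" "c2 \<in> C2" for c1 c2 c1' c2' u v u' v'
  proof -
    have \<kappa>1: "\<kappa> c1 c2 * cnj (\<kappa> c1 c2) = 1" using \<kappa> by (simp add: complex_norm_square[symmetric])
    have "(\<Sum>k\<in>?I. ?M (c1, u, c2, v) k * cnj (?M (c1', u', c2', v') k))
        = (\<Sum>b1\<in>C1. \<Sum>a\<in>A. \<Sum>b2\<in>C2. \<Sum>b\<in>B. if b1 = c1 then if b2 = c2 then
            if c1 = c1' \<and> c2 = c2' then (\<kappa> c1 c2 * cnj (\<kappa> c1 c2)) * (K c1 c2 (u, v) (a, b) * cnj (K c1 c2 (u', v') (a, b))) else 0 else 0 else 0)"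
      unfolding sum.cartesian_product' prod.case by (intro sum.cong refl) auto
    also have "\<dots> = (if c1 = c1' \<and> c2 = c2' then
        \<Sum>a\<in>A. \<Sum>b\<in>B. K c1 c2 (u, v) (a, b) * cnj (K c1 c2 (u', v') (a, b)) else 0)"
      unfolding \<kappa>1 using that fin
      by (cases "c1 = c1' \<and> c2 = c2'") (auto simp: sum_if_const sum.delta)
    finally show ?thesis unfolding sum.cartesian_product' .
  qed
  show ?thesis
  proof
    assume L: "orth_rows ?I ?I s ?M"
    show "\<forall>c1\<in>C1. \<forall>c2\<in>C2. orth_rows (A \<times> B) (A \<times> B) s (K c1 c2)"
    proof (intro ballI orth_rowsI)
      fix c1 c2 i j assume c: "c1 \<in> C1" "c2 \<in> C2" and ij: "i \<in> A \<times> B" "j \<in> A \<times> B"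
      obtain u v u' v' where uv: "i = (u, v)" "j = (u', v')" by (metis surj_pair)
      have "(\<Sum>k\<in>A \<times> B. K c1 c2 i k * cnj (K c1 c2 j k))
          = (\<Sum>k\<in>?I. ?M (c1, u, c2, v) k * cnj (?M (c1, u', c2, v') k))"
        unfolding *[OF c] uv by simp
      also have "\<dots> = (if (c1, u, c2, v) = (c1, u', c2, v') then s else 0)"
        by (rule orth_rowsD[OF L]) (use c ij uv in auto)
      finally show "(\<Sum>k\<in>A \<times> B. K c1 c2 i k * cnj (K c1 c2 j k)) = (if i = j then s else 0)"
        by (simp add: uv)
    qed
  next
    assume R: "\<forall>c1\<in>C1. \<forall>c2\<in>C2. orth_rows (A \<times> B) (A \<times> B) s (K c1 c2)"
    show "orth_rows ?I ?I s ?M"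
    proof (rule orth_rowsI)
      fix i j assume ij: "i \<in> ?I" "j \<in> ?I"
      obtain c1 u c2 v where i: "i = (c1, u, c2, v)" by (metis prod.exhaust)
      obtain c1' u' c2' v' where j: "j = (c1', u', c2', v')" by (metis prod.exhaust)
      have c: "c1 \<in> C1" "c2 \<in> C2" and uv: "(u, v) \<in> A \<times> B" "(u', v') \<in> A \<times> B"
        using ij i j by auto
      show "(\<Sum>k\<in>?I. ?M i k * cnj (?M j k)) = (if i = j then s else 0)"
        unfolding i j *[OF c] using orth_rowsD[OF R[rule_format, OF c] uv] by auto
    qed
  qed
qed

section \<open>Roots of unity\<close>

lemma cis_mult_cnj: "cis a * cnj (cis b) = cis (a - b)"
  by (simp add: complex_eq_iff cos_diff sin_diff)

lemma xi_power: "\<xi> q ^ n = cis (2 * pi * real n / real q)"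
proof -
  have "\<xi> q = cis (2 * pi / real q)"
    by (simp add: \<xi>_def cis_conv_exp mult.commute)
  then show ?thesis by (simp add: DeMoivre mult.commute)
qed

lemma norm_xi_power [simp]: "cmod (\<xi> q ^ n) = 1"
  by (simp add: xi_power)

lemma xi_power_self: "\<xi> p ^ p = 1"
  unfolding xi_power by (cases "p = 0") simp_all

lemma xi_power_mod: "\<xi> p ^ (n mod p) = \<xi> p ^ n"
proof -
  have "\<xi> p ^ n = \<xi> p ^ (p * (n div p) + n mod p)" by simp
  also have "\<dots> = \<xi> p ^ (n mod p)" by (simp only: power_add power_mult xi_power_self) simp
  finally show ?thesis ..
qed

lemma xi_power_mult: "k > 0 \<Longrightarrow> \<xi> (k * p) ^ (k * n) = \<xi> p ^ n"
  by (simp add: xi_power mult.assoc)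

lemma cis_sum_roots:
  assumes K: "K > 0"
  shows "(\<Sum>k<K. cis (2 * pi * real k / real K * of_int n)) = (if int K dvd n then of_nat K else 0)"
proof -
  define z where "z = cis (2 * pi * of_int n / real K)"
  have zk: "cis (2 * pi * real k / real K * of_int n) = z ^ k" for k
    by (simp add: z_def DeMoivre field_simps)
  have zK: "z ^ K = 1" using K by (simp add: z_def DeMoivre cis_multiple_2pi)
  show ?thesis
  proof (cases "int K dvd n")
    case True
    then obtain m where "n = int K * m" by auto
    then have "z = cis (2 * pi * of_int m)" using K by (simp add: z_def mult.assoc)
    then have "z = 1" by (simp add: cis_multiple_2pi)
    with True zk show ?thesis by simp
  next
    case False
    have "z \<noteq> 1"
    proof
      assume "z = 1"
      then have "cos (2 * pi * of_int n / real K) = 1" by (simp add: z_def complex_eq_iff)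
      then obtain m :: int where "2 * pi * of_int n / real K = of_int m * 2 * pi"
        using cos_one_2pi_int by blast
      then have "real_of_int n = real_of_int (int K * m)" using K by (simp add: field_simps)
      then have "n = int K * m" by (simp only: of_int_eq_iff)
      with False show False by simp
    qed
    then have "(\<Sum>k<K. z ^ k) = 0" using geometric_sum[of z K] zK by simp
    with False zk show ?thesis by simp
  qed
qed

lemma dvd_diff_iff_eq:
  assumes "a < K" "b < K"
  shows "int K dvd int a - int b \<longleftrightarrow> a = b"
  using mod_eq_dvd_iff[of "int a" "int K" "int b"] assms by simp

text \<open>Distinct numbers below \<open>K\<close> differ by a non-multiple of \<open>K\<close>, so
  the geometric sum vanishes. Through this lemma, \<open>K\<close> equidistant values of \<theta> do
  the work of an average over all \<theta>.\<close>

lemma orth_rows_fourier: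
  fixes w :: "'a \<Rightarrow> nat"
  assumes inj: "inj_on w Y" and w: "\<And>y. y \<in> Y \<Longrightarrow> w y < K"
  shows "orth_rows Y {..<K} (of_nat K) (\<lambda>y k. cis (2 * pi * real k / real K * real (w y)))"
proof (rule orth_rowsI)
  fix i j assume ij: "i \<in> Y" "j \<in> Y"
  then have K: "K > 0" using w by fastforce
  have "(\<Sum>k<K. cis (2 * pi * real k / real K * real (w i)) * cnj (cis (2 * pi * real k / real K * real (w j))))
      = (\<Sum>k<K. cis (2 * pi * real k / real K * of_int (int (w i) - int (w j))))"
    by (intro sum.cong refl) (simp add: cis_mult_cnj right_diff_distrib)
  also have "\<dots> = (if i = j then of_nat K else 0)"
    unfolding cis_sum_roots[OF K] dvd_diff_iff_eq[OF w[OF ij(1)] w[OF ij(2)]]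
    using inj ij by (auto simp: inj_on_def)
  finally show "(\<Sum>k<K. cis (2 * pi * real k / real K * real (w i)) * cnj (cis (2 * pi * real k / real K * real (w j))))
      = (if i = j then of_nat K else 0)" .
qed

section \<open>Edge matrices and permutations modulo p\<close>

lemma orth_rows_xi:
  "orth_rows {..<p} {..<p} (of_nat p) (\<lambda>a b. \<xi> p ^ (a * b))"
  using orth_rows_fourier[of "\<lambda>a. a" "{..<p}" p] by (simp add: xi_power ac_simps)

lemma permutes_mod_iff: "permutes_mod p f \<longleftrightarrow> inj_on (\<lambda>u. f u mod p) {..<p}"
proof (cases "p = 0")
  case False
  then have "(\<lambda>u. f u mod p) ` {..<p} \<subseteq> {..<p}" by auto
  then show ?thesis unfolding permutes_mod_def bij_betw_def
    using endo_inj_surj[of "{..<p}" "\<lambda>u. f u mod p"] by auto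
qed (simp add: permutes_mod_def bij_betw_def)

lemma xi_prod_mod: "\<xi> p ^ ((a mod p) * (b mod p)) = \<xi> p ^ (a * b)"
  using xi_power_mod[of p "(a mod p) * (b mod p)"] xi_power_mod[of p "a * b"]
  by (simp only: mod_mult_eq)

text \<open>If \<open>f u\<close> and \<open>f v\<close> agree modulo \<open>p\<close>, then the rows of \<open>u\<close> and \<open>v\<close> coincide.\<close>

lemma orth_rows_edge_inj:
  assumes "orth_rows {..<p} {..<p} (of_nat p) (\<lambda>u v. \<xi> p ^ (f u * g v))"
  shows "permutes_mod p f"
  unfolding permutes_mod_iff
proof (rule inj_onI, rule ccontr)
  fix u v assume uv: "u \<in> {..<p}" "v \<in> {..<p}" and eq: "f u mod p = f v mod p" and ne: "u \<noteq> v"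
  have "\<xi> p ^ (f u * g k) = \<xi> p ^ (f v * g k)" for k
    using xi_prod_mod[of p "f u" "g k"] xi_prod_mod[of p "f v" "g k"] eq by simp
  with orth_rowsD[OF assms uv] orth_rowsD[OF assms uv(1,1)] ne uv show False by simp
qed

text \<open>Forwards, transposition exchanges \<open>f\<close> and \<open>g\<close>, so injectivity
  follows for both. Backwards, reindexing the columns along \<open>g\<close> modulo \<open>p\<close>
  leaves the Fourier matrix with its rows permuted by \<open>f\<close>.\<close>

lemma orth_rows_edge_iff:
  "orth_rows {..<p} {..<p} (of_nat p) (\<lambda>u v. \<xi> p ^ (f u * g v)) \<longleftrightarrow> permutes_mod p f \<and> permutes_mod p g"
proof (cases "p = 0")
  case True
  then show ?thesis by (simp add: orth_rows_def permutes_mod_def bij_betw_def)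
next
  case False
  show ?thesis
  proof
    assume L: "orth_rows {..<p} {..<p} (of_nat p) (\<lambda>u v. \<xi> p ^ (f u * g v))"
    have "orth_rows {..<p} {..<p} (of_nat p) (\<lambda>u v. \<xi> p ^ (g u * f v))"
      using orth_rows_transpose[OF L] False by (simp add: mult.commute)
    with L show "permutes_mod p f \<and> permutes_mod p g" using orth_rows_edge_inj by blast
  next
    assume R: "permutes_mod p f \<and> permutes_mod p g"
    show "orth_rows {..<p} {..<p} (of_nat p) (\<lambda>u v. \<xi> p ^ (f u * g v))"
    proof (rule orth_rowsI)
      fix u v assume uv: "u \<in> {..<p}" "v \<in> {..<p}"
      have "(\<Sum>k<p. \<xi> p ^ (f u * g k) * cnj (\<xi> p ^ (f v * g k)))
          = (\<Sum>k<p. \<xi> p ^ ((f u mod p) * (g k mod p)) * cnj (\<xi> p ^ ((f v mod p) * (g k mod p))))"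
        by (simp only: xi_prod_mod)
      also have "\<dots> = (\<Sum>k<p. \<xi> p ^ ((f u mod p) * k) * cnj (\<xi> p ^ ((f v mod p) * k)))"
        using R unfolding permutes_mod_def by (intro sum.reindex_bij_betw) simp
      also have "\<dots> = (if f u mod p = f v mod p then of_nat p else 0)"
        using False by (intro orth_rowsD[OF orth_rows_xi]) auto
      also have "\<dots> = (if u = v then of_nat p else 0)"
        using inj_on_eq_iff[of "\<lambda>u. f u mod p" "{..<p}" u v] R uv by (simp add: permutes_mod_iff)
      finally show "(\<Sum>k<p. \<xi> p ^ (f u * g k) * cnj (\<xi> p ^ (f v * g k))) = (if u = v then of_nat p else 0)" .
    qed
  qed
qed

section \<open>Complementary codes and their spectra\<close>

text \<open>A single double sum covers both signs of the shift, so that later sums over \<tau> can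
  be interchanged without a case distinction.\<close>

lemma correlation_eq:
  assumes "\<bar>\<tau>\<bar> < int L"
  shows "correlation L a b \<tau>
    = (\<Sum>s<L. \<Sum>s'<L. if int s' - int s = \<tau> then a s * cnj (b s') else 0)"
proof (cases "0 \<le> \<tau>")
  case True
  define n where "n = nat \<tau>"
  have eq: "int s' - int s = \<tau> \<longleftrightarrow> s' = s + n" for s s' using True by (auto simp: n_def)
  have "(\<Sum>s<L. \<Sum>s'<L. if int s' - int s = \<tau> then a s * cnj (b s') else 0)
      = (\<Sum>s<L. if s < L - n then a s * cnj (b (s + n)) else 0)"
    by (intro sum.cong refl) (auto simp: eq sum.delta)
  also have "\<dots> = (\<Sum>s\<in>{s\<in>{..<L}. s < L - n}. a s * cnj (b (s + n)))"
    by (rule sum.inter_filter[symmetric]) simp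
  also have "{s\<in>{..<L}. s < L - n} = {..<L - n}" by auto
  finally show ?thesis using True by (simp add: correlation_def n_def)
next
  case False
  define n where "n = nat (- \<tau>)"
  have eq: "int s' - int s = \<tau> \<longleftrightarrow> s = s' + n" for s s' using False by (auto simp: n_def)
  have "(\<Sum>s<L. \<Sum>s'<L. if int s' - int s = \<tau> then a s * cnj (b s') else 0)
      = (\<Sum>s'<L. if s' < L - n then a (s' + n) * cnj (b s') else 0)"
    by (subst sum.swap, intro sum.cong refl) (auto simp: eq sum.delta)
  also have "\<dots> = (\<Sum>s\<in>{s\<in>{..<L}. s < L - n}. a (s + n) * cnj (b s))"
    by (rule sum.inter_filter[symmetric]) simp
  also have "{s\<in>{..<L}. s < L - n} = {..<L - n}" by auto
  finally show ?thesis using False by (simp add: correlation_def n_def)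
qed

definition spectrum :: "nat \<Rightarrow> (nat \<Rightarrow> complex) \<Rightarrow> real \<Rightarrow> complex" where
  "spectrum L a \<theta> = (\<Sum>s<L. a s * cis (\<theta> * real s))"

text \<open>The Wiener-Khinchin relation: the cross spectrum is the trigonometric polynomial whose
  coefficients are the correlations. Grouping the pairs \<open>(s, s')\<close> by
  \<open>s' - s\<close> gives the negative sign in the exponent.\<close>

lemma spectrum_product:
  "spectrum L a \<theta> * cnj (spectrum L b \<theta>)
    = (\<Sum>\<tau>\<in>{- int L<..<int L}. cis (- \<theta> * of_int \<tau>) * correlation L a b \<tau>)"
proof -
  have "spectrum L a \<theta> * cnj (spectrum L b \<theta>)
      = (\<Sum>s<L. \<Sum>s'<L. cis (- \<theta> * of_int (int s' - int s)) * (a s * cnj (b s')))"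
  proof -
    have *: "a s * cis (\<theta> * real s) * cnj (b s' * cis (\<theta> * real s'))
        = cis (- \<theta> * of_int (int s' - int s)) * (a s * cnj (b s'))" for s s'
    proof -
      have "a s * cis (\<theta> * real s) * cnj (b s' * cis (\<theta> * real s'))
          = (cis (\<theta> * real s) * cnj (cis (\<theta> * real s'))) * (a s * cnj (b s'))" by simp
      also have "\<dots> = cis (- \<theta> * of_int (int s' - int s)) * (a s * cnj (b s'))"
        unfolding cis_mult_cnj by (simp add: algebra_simps)
      finally show ?thesis .
    qed
    show ?thesis unfolding spectrum_def cnj_sum sum_product * ..
  qed
  also have "\<dots> = (\<Sum>s<L. \<Sum>s'<L. \<Sum>\<tau>\<in>{- int L<..<int L}.
      if int s' - int s = \<tau> then cis (- \<theta> * of_int \<tau>) * (a s * cnj (b s')) else 0)"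
    by (intro sum.cong refl) (auto simp: sum.delta')
  also have "\<dots> = (\<Sum>s<L. \<Sum>\<tau>\<in>{- int L<..<int L}. \<Sum>s'<L.
      if int s' - int s = \<tau> then cis (- \<theta> * of_int \<tau>) * (a s * cnj (b s')) else 0)"
    by (intro sum.cong refl, rule sum.swap)
  also have "\<dots> = (\<Sum>\<tau>\<in>{- int L<..<int L}. \<Sum>s<L. \<Sum>s'<L.
      if int s' - int s = \<tau> then cis (- \<theta> * of_int \<tau>) * (a s * cnj (b s')) else 0)"
    by (rule sum.swap)
  also have "\<dots> = (\<Sum>\<tau>\<in>{- int L<..<int L}. cis (- \<theta> * of_int \<tau>) * correlation L a b \<tau>)"
  proof (rule sum.cong[OF refl])
    fix \<tau> assume "\<tau> \<in> {- int L<..<int L}"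
    then have "\<bar>\<tau>\<bar> < int L" by auto
    then show "(\<Sum>s<L. \<Sum>s'<L. if int s' - int s = \<tau> then cis (- \<theta> * of_int \<tau>) * (a s * cnj (b s')) else 0)
        = cis (- \<theta> * of_int \<tau>) * correlation L a b \<tau>"
      unfolding correlation_eq[OF \<open>\<bar>\<tau>\<bar> < int L\<close>] sum_distrib_left
      by (intro sum.cong refl) simp
  qed
  finally show ?thesis .
qed

lemma code_spectrum_product:
  "(\<Sum>d\<in>I. spectrum L (A d) \<theta> * cnj (spectrum L (B d) \<theta>))
    = (\<Sum>\<tau>\<in>{- int L<..<int L}. cis (- \<theta> * of_int \<tau>) * code_correlation I L A B \<tau>)"
  unfolding spectrum_product code_correlation_def sum_distrib_left by (rule sum.swap)

text \<open>Fourier inversion by sampling. Two shifts of absolute value below \<open>L\<close>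
  differ by less than \<open>2 * L\<close>, so \<open>2 * L\<close> equidistant sample points
  separate all of them.\<close>

lemma code_correlation_spectrum:
  assumes \<tau>: "\<bar>\<tau>\<bar> < int L"
  shows "of_nat (2 * L) * code_correlation I L A B \<tau>
    = (\<Sum>k<2 * L. cis (2 * pi * real k / real (2 * L) * of_int \<tau>) *
        (\<Sum>d\<in>I. spectrum L (A d) (2 * pi * real k / real (2 * L)) *
          cnj (spectrum L (B d) (2 * pi * real k / real (2 * L)))))"
proof -
  let ?t = "\<lambda>k. 2 * pi * real k / real (2 * L)"
  have L: "2 * L > 0" using \<tau> by auto
  have "(\<Sum>k<2 * L. cis (?t k * of_int \<tau>) * (\<Sum>d\<in>I. spectrum L (A d) (?t k) * cnj (spectrum L (B d) (?t k))))
      = (\<Sum>k<2 * L. \<Sum>\<sigma>\<in>{- int L<..<int L}. cis (?t k * of_int (\<tau> - \<sigma>)) * code_correlation I L A B \<sigma>)"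
    unfolding code_spectrum_product sum_distrib_left mult.assoc[symmetric] cis_mult
    by (intro sum.cong refl) (simp add: right_diff_distrib)
  also have "\<dots> = (\<Sum>\<sigma>\<in>{- int L<..<int L}. (\<Sum>k<2 * L. cis (?t k * of_int (\<tau> - \<sigma>))) * code_correlation I L A B \<sigma>)"
    unfolding sum_distrib_right by (rule sum.swap)
  also have "\<dots> = (\<Sum>\<sigma>\<in>{- int L<..<int L}. if \<tau> = \<sigma> then of_nat (2 * L) * code_correlation I L A B \<sigma> else 0)"
  proof (intro sum.cong refl)
    fix \<sigma> assume "\<sigma> \<in> {- int L<..<int L}"
    then have "\<bar>\<tau> - \<sigma>\<bar> < int (2 * L)" using \<tau> by auto
    then have "int (2 * L) dvd \<tau> - \<sigma> \<longleftrightarrow> \<tau> = \<sigma>"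
      using zdvd_imp_le[of "int (2 * L)" "\<bar>\<tau> - \<sigma>\<bar>"] by fastforce
    then show "(\<Sum>k<2 * L. cis (?t k * of_int (\<tau> - \<sigma>))) * code_correlation I L A B \<sigma>
        = (if \<tau> = \<sigma> then of_nat (2 * L) * code_correlation I L A B \<sigma> else 0)"
      unfolding cis_sum_roots[OF L] by simp
  qed
  also have "\<dots> = of_nat (2 * L) * code_correlation I L A B \<tau>"
    using \<tau> by (subst sum.delta') auto
  finally show ?thesis ..
qed

text \<open>Correlations concentrated at shift 0 have a constant cross spectrum, and inversion of a
  constant cross spectrum returns such correlations.\<close>

lemma is_CCC_iff_spectrum:
  assumes L: "L > 0"
  shows "is_CCC I M L A \<longleftrightarrow> finite I \<and> card I = M \<and>
    (\<forall>\<theta>. orth_rows {..<M} I (of_nat (M * L)) (\<lambda>t d. spectrum L (A t d) \<theta>))"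
proof -
  have "(\<forall>k1<M. \<forall>k2<M. \<forall>\<tau>::int. \<bar>\<tau>\<bar> < int L \<longrightarrow>
        code_correlation I L (A k1) (A k2) \<tau> = (if \<tau> = 0 \<and> k1 = k2 then of_nat (M * L) else 0))
    \<longleftrightarrow> (\<forall>\<theta>. orth_rows {..<M} I (of_nat (M * L)) (\<lambda>t d. spectrum L (A t d) \<theta>))" (is "?C \<longleftrightarrow> ?S")
  proof
    assume C: ?C
    show ?S
    proof (intro allI orth_rowsI)
      fix \<theta> i j assume "i \<in> {..<M}" "j \<in> {..<M}"
      then have "(\<Sum>d\<in>I. spectrum L (A i d) \<theta> * cnj (spectrum L (A j d) \<theta>))
          = (\<Sum>\<tau>\<in>{- int L<..<int L}. if \<tau> = 0 then (if i = j then of_nat (M * L) else 0) else 0)"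
        unfolding code_spectrum_product using C by (intro sum.cong refl) auto
      also have "\<dots> = (if i = j then of_nat (M * L) else 0)" using L by (subst sum.delta) auto
      finally show "(\<Sum>d\<in>I. spectrum L (A i d) \<theta> * cnj (spectrum L (A j d) \<theta>))
          = (if i = j then of_nat (M * L) else 0)" .
    qed
  next
    assume S: ?S
    show ?C
    proof (intro allI impI)
      fix i j and \<tau> :: int assume ij: "i < M" "j < M" and \<tau>: "\<bar>\<tau>\<bar> < int L"
      have L2: "2 * L > 0" using L by simp
      have "int (2 * L) dvd \<tau> \<longleftrightarrow> \<tau> = 0"
        using \<tau> zdvd_imp_le[of "int (2 * L)" "\<bar>\<tau>\<bar>"] by fastforce
      moreover have "of_nat (2 * L) * code_correlation I L (A i) (A j) \<tau>
          = (\<Sum>k<2 * L. cis (2 * pi * real k / real (2 * L) * of_int \<tau>)) * (if i = j then of_nat (M * L) else 0)"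
        unfolding code_correlation_spectrum[OF \<tau>] sum_distrib_right
        using ij by (intro sum.cong refl arg_cong2[where f="(*)"] orth_rowsD[OF S[rule_format]]) auto
      ultimately have "of_nat (2 * L) * code_correlation I L (A i) (A j) \<tau>
          = of_nat (2 * L) * (if \<tau> = 0 \<and> i = j then of_nat (M * L) else 0)"
        unfolding cis_sum_roots[OF L2] by simp
      moreover have "of_nat (2 * L) \<noteq> (0 :: complex)" using L2 by (simp only: of_nat_eq_0_iff)
      ultimately show "code_correlation I L (A i) (A j) \<tau> = (if \<tau> = 0 \<and> i = j then of_nat (M * L) else 0)"
        using mult_left_cancel by blast
    qed
  qed
  then show ?thesis by (simp add: is_CCC_def)
qed

section \<open>Sums over paths\<close>

lemma finite_Zvec [simp]: "finite (Zvec p n)"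
  by (simp add: Zvec_def finite_PiE)

lemma card_Zvec [simp]: "card (Zvec p n) = p ^ n"
  by (simp add: Zvec_def card_PiE)

lemma Zvec_less: "y \<in> Zvec p n \<Longrightarrow> i \<in> {1..n} \<Longrightarrow> y i < p"
  by (auto simp: Zvec_def)

lemma Zvec_extend: "y \<in> Zvec p n \<Longrightarrow> b < p \<Longrightarrow> y(Suc n := b) \<in> Zvec p (Suc n)"
  by (auto simp: Zvec_def PiE_iff extensional_def)

lemma Zvec_restrict: "y \<in> Zvec p (Suc n) \<Longrightarrow> restrict y {1..n} \<in> Zvec p n"
  by (auto simp: Zvec_def PiE_iff)

lemma Zvec_restrict_extend: "y \<in> Zvec p (Suc n) \<Longrightarrow> (restrict y {1..n})(Suc n := y (Suc n)) = y"
  by (auto simp: Zvec_def PiE_iff extensional_def fun_eq_iff)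

lemma Zvec_extend_restrict: "y \<in> Zvec p n \<Longrightarrow> restrict (y(Suc n := b)) {1..n} = y"
  by (auto simp: Zvec_def PiE_iff extensional_def fun_eq_iff)

definition path_weight ::
  "nat \<Rightarrow> (nat \<Rightarrow> nat \<Rightarrow> complex) \<Rightarrow> (nat \<Rightarrow> nat \<Rightarrow> nat \<Rightarrow> complex) \<Rightarrow> (nat \<Rightarrow> nat) \<Rightarrow> complex" where
  "path_weight N w F y = (\<Prod>i=1..N. w i (y i)) * (\<Prod>i=1..N - 1. F i (y i) (y (i + 1)))"

text \<open>The entries of \<open>D\<^sub>1 F\<^sub>1 D\<^sub>2 \<dots> F\<^bsub>N-1\<^esub> D\<^sub>N\<close>, where \<open>D\<^sub>i\<close> is the diagonal matrix of \<open>w i\<close>.\<close>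

definition chain ::
  "nat \<Rightarrow> nat \<Rightarrow> (nat \<Rightarrow> nat \<Rightarrow> complex) \<Rightarrow> (nat \<Rightarrow> nat \<Rightarrow> nat \<Rightarrow> complex) \<Rightarrow> nat \<Rightarrow> nat \<Rightarrow> complex" where
  "chain p N w F u a = (\<Sum>y\<in>{y\<in>Zvec p N. y 1 = u \<and> y N = a}. path_weight N w F y)"

text \<open>The recursion of the matrix product: the last vertex of a path is fixed to be
  \<open>b\<close>, and after removing it the paths are grouped by their new last value
  \<open>a\<close>.\<close>

lemma chain_Suc:
  assumes N: "N \<ge> 1" and b: "b < p"
  shows "chain p (Suc N) w F u b = (\<Sum>a<p. chain p N w F u a * F N a b) * w (Suc N) b"
proof -
  define Y where "Y = {y\<in>Zvec p N. y 1 = u}"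
  have ext: "path_weight (Suc N) w F (y(Suc N := b)) = path_weight N w F y * F N (y N) b * w (Suc N) b"
    for y
  proof -
    obtain n where n: "N = Suc n" using N by (cases N) auto
    have "(\<Prod>i=1..N. F i ((y(Suc N := b)) i) ((y(Suc N := b)) (i + 1)))
        = (\<Prod>i=1..n. F i (y i) (y (i + 1))) * F N (y N) b"
      unfolding n by (simp add: prod.nat_ivl_Suc')
    then show ?thesis
      by (simp add: path_weight_def n prod.nat_ivl_Suc' ac_simps)
  qed
  have "chain p (Suc N) w F u b = (\<Sum>y\<in>Y. path_weight (Suc N) w F (y(Suc N := b)))"
    unfolding chain_def
  proof (rule sum.reindex_bij_witness[where i = "\<lambda>y. y(Suc N := b)" and j = "\<lambda>y. restrict y {1..N}"])
    fix y assume y: "y \<in> {y\<in>Zvec p (Suc N). y 1 = u \<and> y (Suc N) = b}"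
    then show yy: "(restrict y {1..N})(Suc N := b) = y" using Zvec_restrict_extend[of y p N] by auto
    show "restrict y {1..N} \<in> Y" using y N Zvec_restrict[of y p N] by (auto simp: Y_def)
    show "path_weight (Suc N) w F ((restrict y {1..N})(Suc N := b)) = path_weight (Suc N) w F y"
      unfolding yy ..
  next
    fix y assume y: "y \<in> Y"
    then show "restrict (y(Suc N := b)) {1..N} = y" by (intro Zvec_extend_restrict) (auto simp: Y_def)
    show "y(Suc N := b) \<in> {y\<in>Zvec p (Suc N). y 1 = u \<and> y (Suc N) = b}"
      using y N b Zvec_extend[of y p N b] by (auto simp: Y_def)
  qed
  also have "\<dots> = (\<Sum>y\<in>Y. path_weight N w F y * F N (y N) b * w (Suc N) b)"
    unfolding ext ..
  also have "\<dots> = (\<Sum>a<p. \<Sum>y\<in>{y\<in>Y. y N = a}. path_weight N w F y * F N (y N) b * w (Suc N) b)"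
    using N by (intro sum.group[symmetric]) (auto simp: Y_def intro: Zvec_less)
  also have "\<dots> = (\<Sum>a<p. chain p N w F u a * F N a b * w (Suc N) b)"
    unfolding chain_def sum_distrib_right
    by (intro sum.cong refl) (auto simp: Y_def)
  finally show ?thesis by (simp add: sum_distrib_right)
qed

lemma chain_1:
  assumes "u < p" "a < p"
  shows "chain p 1 w F u a = (if u = a then w 1 a else 0)"
proof -
  have "{y\<in>Zvec p 1. y 1 = u \<and> y 1 = a} = (if u = a then {\<lambda>i\<in>{1}. a} else {})"
    using assms by (auto simp: Zvec_def PiE_iff extensional_def fun_eq_iff)
  then show ?thesis unfolding chain_def by (simp add: path_weight_def)
qed

text \<open>The characters and the link between the two paths involve only the end points of a path.
  This lemma absorbs all interior vertices into matrix entries of \<open>chain\<close>.\<close>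

lemma sum_Zvec_ends:
  assumes N: "N \<ge> 1"
  shows "(\<Sum>y\<in>Zvec p N. path_weight N w F y * g (y 1) (y N))
    = (\<Sum>u<p. \<Sum>a<p. chain p N w F u a * g u a)"
proof -
  have "(\<Sum>y\<in>Zvec p N. path_weight N w F y * g (y 1) (y N))
      = (\<Sum>u<p. \<Sum>y\<in>{y\<in>Zvec p N. y 1 = u}. path_weight N w F y * g (y 1) (y N))"
    using N by (intro sum.group[symmetric]) (auto intro: Zvec_less)
  also have "\<dots> = (\<Sum>u<p. \<Sum>a<p. \<Sum>y\<in>{y\<in>{y\<in>Zvec p N. y 1 = u}. y N = a}. path_weight N w F y * g (y 1) (y N))"
    using N by (intro sum.cong[OF refl] sum.group[symmetric]) (auto intro: Zvec_less)
  also have "\<dots> = (\<Sum>u<p. \<Sum>a<p. chain p N w F u a * g u a)"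
    unfolding chain_def sum_distrib_right by (intro sum.cong refl) auto
  finally show ?thesis .
qed

lemma orth_rows_chain:
  assumes N: "N \<ge> 1"
    and w: "\<And>i u. i \<in> {1..N} \<Longrightarrow> u < p \<Longrightarrow> cmod (w i u) = 1"
    and F: "\<And>i. i \<in> {1..N - 1} \<Longrightarrow> orth_rows {..<p} {..<p} (of_nat p) (F i)"
  shows "orth_rows {..<p} {..<p} (of_nat (p ^ (N - 1))) (chain p N w F)"
  using assms
proof (induction N rule: nat_induct_at_least)
  case base
  have "orth_rows {..<p} {..<p} 1 (\<lambda>u a. (if u = a then 1 else 0) * w 1 a)"
  proof (subst orth_rows_scale)
    show "orth_rows {..<p} {..<p} 1 (\<lambda>i k. if i = k then 1 else 0)"
    proof (rule orth_rowsI)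
      fix i j assume "i \<in> {..<p}" "j \<in> {..<p}"
      have "(\<Sum>k<p. (if i = k then 1 else 0) * cnj (if j = k then 1 else 0))
          = (\<Sum>k<p. if i = k then (if i = j then 1 else 0) else (0 :: complex))"
        by (intro sum.cong) auto
      with \<open>i \<in> {..<p}\<close> show "(\<Sum>k<p. (if i = k then 1 else 0) * cnj (if j = k then 1 else 0))
          = (if i = j then 1 else (0 :: complex))"
        by (simp add: sum.delta')
    qed
  qed (use base in auto)
  moreover have "chain p 1 w F u a = (if u = a then 1 else 0) * w 1 a" if "u < p" "a < p" for u a
    using chain_1[OF that, of w F] by simp
  ultimately show ?case by (subst orth_rows_cong[where N="\<lambda>u a. (if u = a then 1 else 0) * w 1 a"]) auto
next
  case (Suc N)
  have "orth_rows {..<p} {..<p} (of_nat (p ^ (N - 1))) (chain p N w F)"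
    by (rule Suc.IH) (use Suc.prems in auto)
  then have "orth_rows {..<p} {..<p} (of_nat (p ^ (N - 1)) * of_nat p)
      (\<lambda>u b. \<Sum>a<p. chain p N w F u a * F N a b)"
    by (rule orth_rows_mult) (use Suc in auto)
  then have "orth_rows {..<p} {..<p} (of_nat (p ^ (N - 1)) * of_nat p)
      (\<lambda>u b. (\<Sum>a<p. chain p N w F u a * F N a b) * w (Suc N) b)"
    by (subst orth_rows_scale) (use Suc in auto)
  moreover have "of_nat (p ^ (N - 1)) * of_nat p = (of_nat (p ^ (Suc N - 1)) :: complex)"
    using Suc.hyps by (cases N) auto
  ultimately show ?case using Suc.hyps
    by (subst orth_rows_cong[where N="\<lambda>u b. (\<Sum>a<p. chain p N w F u a * F N a b) * w (Suc N) b"])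
      (auto simp: chain_Suc)
qed

lemma prod_cis: "(\<Prod>i\<in>A. cis (f i)) = cis (\<Sum>i\<in>A. f i)"
  by (induction A rule: infinite_finite_induct) (auto simp: cis_mult)

lemma path_weight_cis:
  "path_weight N (\<lambda>i u. g i u * cis (\<theta> * real (u * W i))) F y
    = path_weight N g F y * cis (\<theta> * real (\<Sum>i=1..N. y i * W i))"
proof -
  have "(\<Prod>i=1..N. g i (y i) * cis (\<theta> * real (y i * W i)))
      = (\<Prod>i=1..N. g i (y i)) * cis (\<theta> * real (\<Sum>i=1..N. y i * W i))"
    by (simp add: prod.distrib prod_cis sum_distrib_left)
  then show ?thesis by (simp add: path_weight_def)
qed

lemma norm_path_weight:
  assumes "\<And>i u. i \<in> {1..N} \<Longrightarrow> u < p \<Longrightarrow> cmod (g i u) = 1"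
    and "\<And>i u v. i \<in> {1..N - 1} \<Longrightarrow> u < p \<Longrightarrow> v < p \<Longrightarrow> cmod (F i u v) = 1"
    and y: "y \<in> Zvec p N"
  shows "cmod (path_weight N g F y) = 1"
proof -
  have "cmod (\<Prod>i=1..N. g i (y i)) = 1"
    unfolding prod_norm[symmetric] using assms(1) Zvec_less[OF y] by (intro prod.neutral) auto
  moreover have "cmod (\<Prod>i=1..N - 1. F i (y i) (y (i + 1))) = 1"
    unfolding prod_norm[symmetric]
  proof (intro prod.neutral ballI)
    fix i assume i: "i \<in> {1..N - 1}"
    then show "cmod (F i (y i) (y (i + 1))) = 1"
      using Zvec_less[OF y, of i] Zvec_less[OF y, of "i + 1"] by (intro assms(2)) auto
  qed
  ultimately show ?thesis by (simp add: path_weight_def norm_mult)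
qed

text \<open>For fixed ends \<open>u\<close> and \<open>a\<close>, the entry of the chain is a
  trigonometric polynomial in \<theta> with one unimodular coefficient per path, and
  \<open>inj\<close> makes the frequencies distinct. By Parseval its mean square is the number of
  these paths, and there are \<open>p ^ N\<close> paths in total.\<close>

lemma chain_parseval:
  assumes N: "N \<ge> 1"
    and g: "\<And>i u. i \<in> {1..N} \<Longrightarrow> u < p \<Longrightarrow> cmod (g i u) = 1"
    and F: "\<And>i u v. i \<in> {1..N - 1} \<Longrightarrow> u < p \<Longrightarrow> v < p \<Longrightarrow> cmod (F i u v) = 1"
    and inj: "inj_on (\<lambda>y. \<Sum>i=1..N. y i * W i) (Zvec p N)"
    and K: "\<And>y. y \<in> Zvec p N \<Longrightarrow> (\<Sum>i=1..N. y i * W i) < K"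
  shows "(\<Sum>k<K. \<Sum>u<p. \<Sum>a<p.
      (cmod (chain p N (\<lambda>i u. g i u * cis (2 * pi * real k / real K * real (u * W i))) F u a))\<^sup>2)
    = real K * real (p ^ N)"
proof -
  let ?Y = "\<lambda>u a. {y\<in>Zvec p N. y 1 = u \<and> y N = a}"
  let ?t = "\<lambda>k. 2 * pi * real k / real K"
  have "(\<Sum>k<K. (cmod (chain p N (\<lambda>i u. g i u * cis (?t k * real (u * W i))) F u a))\<^sup>2)
      = real K * real (card (?Y u a))" for u a
  proof -
    have "orth_rows (?Y u a) {..<K} (of_real (real K)) (\<lambda>y k. cis (?t k * real (\<Sum>i=1..N. y i * W i)))"
      unfolding of_real_of_nat_eq
    proof (rule orth_rows_fourier)
      show "inj_on (\<lambda>y. \<Sum>i=1..N. y i * W i) (?Y u a)"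
        by (rule inj_on_subset[OF inj]) auto
    qed (use K in auto)
    from orth_rows_norm[OF this, of "path_weight N g F"]
    have "(\<Sum>k<K. (cmod (chain p N (\<lambda>i u. g i u * cis (?t k * real (u * W i))) F u a))\<^sup>2)
        = real K * (\<Sum>y\<in>?Y u a. (cmod (path_weight N g F y))\<^sup>2)"
      unfolding chain_def path_weight_cis by simp
    also have "(\<Sum>y\<in>?Y u a. (cmod (path_weight N g F y))\<^sup>2) = (\<Sum>y\<in>?Y u a. 1)"
      using norm_path_weight[of N p g F] g F by (intro sum.cong) auto
    finally show ?thesis by simp
  qed
  then have "(\<Sum>u<p. \<Sum>a<p. \<Sum>k<K. (cmod (chain p N (\<lambda>i u. g i u * cis (?t k * real (u * W i))) F u a))\<^sup>2)
      = real K * (\<Sum>u<p. \<Sum>a<p. real (card (?Y u a)))"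
    by (simp add: sum_distrib_left)
  also have "(\<Sum>u<p. \<Sum>a<p. real (card (?Y u a))) = real (p ^ N)"
  proof -
    have "(\<Sum>u<p. \<Sum>a<p. card (?Y u a)) = (\<Sum>u<p. card {y\<in>Zvec p N. y 1 = u})"
    proof (rule sum.cong[OF refl])
      fix u
      have "(\<Sum>a<p. \<Sum>y\<in>{y\<in>{y\<in>Zvec p N. y 1 = u}. y N = a}. 1::nat) = (\<Sum>y\<in>{y\<in>Zvec p N. y 1 = u}. 1)"
        using N by (intro sum.group) (auto intro: Zvec_less)
      then show "(\<Sum>a<p. card (?Y u a)) = card {y\<in>Zvec p N. y 1 = u}" by (simp add: conj_assoc)
    qed
    also have "\<dots> = p ^ N"
    proof -
      have "(\<Sum>u<p. \<Sum>y\<in>{y\<in>Zvec p N. y 1 = u}. 1::nat) = (\<Sum>y\<in>Zvec p N. 1)"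
        using N by (intro sum.group) (auto intro: Zvec_less)
      then show ?thesis by simp
    qed
    finally show ?thesis by (simp only: flip: of_nat_sum)
  qed
  finally have *: "(\<Sum>u<p. \<Sum>a<p. \<Sum>k<K.
      (cmod (chain p N (\<lambda>i u. g i u * cis (?t k * real (u * W i))) F u a))\<^sup>2) = real K * real (p ^ N)" .
  show ?thesis
    unfolding *[symmetric] by (rule trans[OF sum.swap sum.cong[OF refl sum.swap]])
qed

lemma inj_on_Zvec_Suc:
  assumes inj: "inj_on (\<lambda>y. \<Sum>i=1..Suc N. y i * W i) (Zvec p (Suc N))" and p: "p > 0"
  shows "inj_on (\<lambda>y. \<Sum>i=1..N. y i * W i) (Zvec p N)"
proof (rule inj_onI)
  fix y z assume yz: "y \<in> Zvec p N" "z \<in> Zvec p N"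
    and eq: "(\<Sum>i=1..N. y i * W i) = (\<Sum>i=1..N. z i * W i)"
  have "y(Suc N := 0) = z(Suc N := 0)"
    using eq by (intro inj_onD[OF inj] Zvec_extend yz p) simp
  then show "y = z" using Zvec_extend_restrict[OF yz(1)] Zvec_extend_restrict[OF yz(2)] by metis
qed

text \<open>The long chain is the short chain times \<open>F N\<close> times a diagonal unitary
  matrix. By \<open>chain_parseval\<close> the mean of the scale \<open>s\<close> and the mean
  squared Frobenius norm of the short chain are both \<open>p ^ N\<close>, so at some sample point
  the norm is at most the scale, as \<open>orth_rows_factor\<close> demands. Once \<open>F N\<close>
  is known to be orthogonal it cancels for every \<theta>, and the short chain satisfies the
  induction hypothesis.\<close>

lemma chain_edges_orth:
  assumes N: "N \<ge> 1" and p: "p > 0"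
    and g: "\<And>i u. i \<in> {1..N} \<Longrightarrow> u < p \<Longrightarrow> cmod (g i u) = 1"
    and F: "\<And>i u v. i \<in> {1..N - 1} \<Longrightarrow> u < p \<Longrightarrow> v < p \<Longrightarrow> cmod (F i u v) = 1"
    and inj: "inj_on (\<lambda>y. \<Sum>i=1..N. y i * W i) (Zvec p N)"
    and orth: "\<And>\<theta>. \<exists>s. s \<noteq> 0 \<and>
      orth_rows {..<p} {..<p} s (chain p N (\<lambda>i u. g i u * cis (\<theta> * real (u * W i))) F)"
    and i: "i \<in> {1..N - 1}"
  shows "orth_rows {..<p} {..<p} (of_nat p) (F i)"
  using assms
proof (induction N rule: nat_induct_at_least)
  case base
  then show ?case by simp
next
  case (Suc N)
  define w where "w \<theta> = (\<lambda>i u. g i u * cis (\<theta> * real (u * W i)))" for \<theta> :: real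
  have wN: "cmod (w \<theta> (Suc N) u) = 1" if "u < p" for \<theta> u
    using Suc.prems(2)[of "Suc N" u] that by (simp add: w_def norm_mult)
  have injN: "inj_on (\<lambda>y. \<Sum>i=1..N. y i * W i) (Zvec p N)"
    using inj_on_Zvec_Suc[OF Suc.prems(4) p] .
  \<comment> \<open>The scale equals the squared norm of row 0, hence is real and nonnegative; being
    nonzero, it is positive.\<close>
  have "\<exists>s. s > 0 \<and> orth_rows {..<p} {..<p} (of_real s) (chain p (Suc N) (w \<theta>) F)" for \<theta>
  proof -
    obtain s where s: "s \<noteq> 0" "orth_rows {..<p} {..<p} s (chain p (Suc N) (w \<theta>) F)"
      using Suc.prems(5)[of \<theta>] unfolding w_def by blast
    define r where "r = (\<Sum>k<p. (cmod (chain p (Suc N) (w \<theta>) F 0 k))\<^sup>2)"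
    have r: "s = of_real r" "r \<ge> 0"
      using orth_rows_real[OF s(2), of 0] p by (auto simp: r_def intro!: sum_nonneg)
    with s show ?thesis by (intro exI[of _ r]) auto
  qed
  then obtain s where s: "\<And>\<theta>. s \<theta> > 0"
    and oS: "\<And>\<theta>. orth_rows {..<p} {..<p} (of_real (s \<theta>)) (chain p (Suc N) (w \<theta>) F)" by metis
  have oS': "orth_rows {..<p} {..<p} (of_real (s \<theta>)) (\<lambda>u b. \<Sum>a<p. chain p N (w \<theta>) F u a * F N a b)" for \<theta>
  proof -
    have "orth_rows {..<p} {..<p} (of_real (s \<theta>))
        (\<lambda>u b. (\<Sum>a<p. chain p N (w \<theta>) F u a * F N a b) * w \<theta> (Suc N) b)"
      using oS[of \<theta>] Suc.hyps
      by (subst (asm) orth_rows_cong[where N="\<lambda>u b. (\<Sum>a<p. chain p N (w \<theta>) F u a * F N a b) * w \<theta> (Suc N) b"])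
        (auto simp: chain_Suc)
    then show ?thesis by (subst (asm) orth_rows_scale) (use wN in auto)
  qed
  \<comment> \<open>A common strict bound on the frequencies of long and short paths, so that both
    means are taken over the same sample points.\<close>
  define K where "K = Suc (\<Sum>y\<in>Zvec p (Suc N). \<Sum>i=1..Suc N. y i * W i)"
  have K1: "(\<Sum>i=1..Suc N. y i * W i) < K" if "y \<in> Zvec p (Suc N)" for y
    unfolding K_def less_Suc_eq_le using that by (intro member_le_sum) auto
  have K0: "(\<Sum>i=1..N. y i * W i) < K" if "y \<in> Zvec p N" for y
    using K1[OF Zvec_extend[OF that p]] by simp
  let ?t = "\<lambda>k. 2 * pi * real k / real K"
  have "(\<Sum>k<K. real p * s (?t k)) = (\<Sum>k<K. \<Sum>u<p. \<Sum>a<p. (cmod (chain p (Suc N) (w (?t k)) F u a))\<^sup>2)"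
  proof (rule sum.cong[OF refl])
    fix k
    have "(\<Sum>a<p. (cmod (chain p (Suc N) (w (?t k)) F u a))\<^sup>2) = s (?t k)" if "u < p" for u
      using orth_rows_real[OF oS[of "?t k"], of u] that by (simp only: of_real_eq_iff) simp
    then show "real p * s (?t k) = (\<Sum>u<p. \<Sum>a<p. (cmod (chain p (Suc N) (w (?t k)) F u a))\<^sup>2)"
      by simp
  qed
  also have "\<dots> = real K * real (p ^ Suc N)"
    unfolding w_def by (rule chain_parseval) (use Suc.prems K1 in auto)
  finally have "(\<Sum>k<K. s (?t k)) = real K * real (p ^ N)"
    using p by (simp flip: sum_distrib_left)
  also have "\<dots> = (\<Sum>k<K. \<Sum>u<p. \<Sum>a<p. (cmod (chain p N (w (?t k)) F u a))\<^sup>2)"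
    unfolding w_def by (rule chain_parseval[symmetric]) (use Suc.prems Suc.hyps injN K0 in auto)
  finally have sums: "(\<Sum>k<K. s (?t k)) = (\<Sum>k<K. \<Sum>u<p. \<Sum>a<p. (cmod (chain p N (w (?t k)) F u a))\<^sup>2)" .
  \<comment> \<open>Equal sums over the sample points exclude a strict inequality at all of
    them.\<close>
  have "\<exists>k<K. (\<Sum>u<p. \<Sum>a<p. (cmod (chain p N (w (?t k)) F u a))\<^sup>2) \<le> s (?t k)"
  proof (rule ccontr)
    assume "\<not> ?thesis"
    then have "(\<Sum>k<K. s (?t k)) < (\<Sum>k<K. \<Sum>u<p. \<Sum>a<p. (cmod (chain p N (w (?t k)) F u a))\<^sup>2)"
      by (intro sum_strict_mono) (auto simp: K_def not_le)
    with sums show False by simp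
  qed
  then obtain k where "(\<Sum>u<p. \<Sum>a<p. (cmod (chain p N (w (?t k)) F u a))\<^sup>2) \<le> s (?t k)" by blast
  from orth_rows_factor[OF oS' s _ _ this]
  have FN: "orth_rows {..<p} {..<p} (of_nat p) (F N)" using Suc.prems(3)[of N] Suc.hyps by simp
  show ?case
  proof (cases "i = N")
    case True
    then show ?thesis using FN by simp
  next
    case False
    show ?thesis
    proof (rule Suc.IH)
      fix \<theta>
      have "orth_rows {..<p} {..<p} (of_real (s \<theta>) / of_nat p) (chain p N (w \<theta>) F)"
      proof (rule orth_rows_cancel_right[OF oS' FN])
        show "of_real (s \<theta>) \<noteq> (0 :: complex)" using s[of \<theta>] by simp
      qed (use p in \<open>auto simp: lessThan_empty_iff\<close>)
      then show "\<exists>s. s \<noteq> 0 \<and> orth_rows {..<p} {..<p} s (chain p N (\<lambda>i u. g i u * cis (\<theta> * real (u * W i))) F)"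
        using s[of \<theta>] p unfolding w_def by (intro exI[of _ "of_real (s \<theta>) / of_nat p"]) auto
    qed (use Suc.prems injN False in auto)
  qed
qed

section \<open>Splitting the variables\<close>

text \<open>By distributivity the sum over \<open>c\<close> is a product of one-dimensional
  character sums, and one coordinate where \<open>d\<close> and \<open>d'\<close> differ makes it
  vanish.\<close>

lemma orth_rows_Zvec:
  "orth_rows (Zvec p n) (Zvec p n) (of_nat (p ^ n)) (\<lambda>d c. \<xi> p ^ (\<Sum>v=1..n. d v * c v))"
proof (rule orth_rowsI)
  fix d d' assume d: "d \<in> Zvec p n" "d' \<in> Zvec p n"
  have "(\<Sum>c\<in>Zvec p n. \<xi> p ^ (\<Sum>v=1..n. d v * c v) * cnj (\<xi> p ^ (\<Sum>v=1..n. d' v * c v)))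
      = (\<Sum>c\<in>{1..n} \<rightarrow>\<^sub>E {..<p}. \<Prod>v\<in>{1..n}. \<xi> p ^ (d v * c v) * cnj (\<xi> p ^ (d' v * c v)))"
    by (simp add: Zvec_def power_sum prod.distrib)
  also have "\<dots> = (\<Prod>v\<in>{1..n}. \<Sum>k<p. \<xi> p ^ (d v * k) * cnj (\<xi> p ^ (d' v * k)))"
    by (rule prod_sum_PiE[symmetric]) auto
  also have "\<dots> = (\<Prod>v\<in>{1..n}. if d v = d' v then of_nat p else 0)"
    by (intro prod.cong refl orth_rowsD[OF orth_rows_xi]) (use d in \<open>auto intro: Zvec_less\<close>)
  also have "\<dots> = (if d = d' then of_nat (p ^ n) else 0)"
  proof (cases "d = d'")
    case False
    then obtain v where "v \<in> {1..n}" "d v \<noteq> d' v"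
      using d unfolding Zvec_def by (metis PiE_ext)
    then have "(\<Prod>v\<in>{1..n}. if d v = d' v then of_nat p else (0 :: complex)) = 0"
      by (intro prod_zero) auto
    with False show ?thesis by simp
  qed simp
  finally show "(\<Sum>c\<in>Zvec p n. \<xi> p ^ (\<Sum>v=1..n. d v * c v) * cnj (\<xi> p ^ (\<Sum>v=1..n. d' v * c v)))
      = (if d = d' then of_nat (p ^ n) else 0)" .
qed

section \<open>Mixed radix numbers and positions in a sequence\<close>

lemma undigits_less:
  assumes "\<And>j. j \<in> {1..n} \<Longrightarrow> v j < p"
  shows "undigits p n v < p ^ n"
  using assms
proof (induction n)
  case (Suc n)
  then have "undigits p n v < p ^ n" by simp
  moreover have "(v (Suc n) + 1) * p ^ n \<le> p * p ^ n"
    using Suc.prems[of "Suc n"] by (intro mult_le_mono1) simp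
  ultimately show ?case by (simp add: undigits_def algebra_simps)
qed (simp add: undigits_def)

lemma label_less:
  assumes "c1 \<in> Zvec p1 n1" "c2 \<in> Zvec p2 n2"
  shows "label p1 n1 p2 n2 c1 c2 < p1 ^ n1 * p2 ^ n2"
proof -
  have "undigits p1 n1 c1 < p1 ^ n1" "undigits p2 n2 c2 < p2 ^ n2"
    using Zvec_less[OF assms(1)] Zvec_less[OF assms(2)] by (auto intro!: undigits_less)
  then have "undigits p1 n1 c1 + p1 ^ n1 * undigits p2 n2 c2 < p1 ^ n1 * (1 + undigits p2 n2 c2)"
    "p1 ^ n1 * (1 + undigits p2 n2 c2) \<le> p1 ^ n1 * p2 ^ n2"
    by (simp, intro mult_le_mono2, simp)
  then show ?thesis by (simp add: label_def)
qed

text \<open>The place value of the variable with index \<open>j\<close> in the position of a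
  sequence entry. With it the phase of an entry at \<theta> splits into one factor per
  variable.\<close>

definition weight :: "nat \<Rightarrow> nat \<Rightarrow> nat \<Rightarrow> nat \<Rightarrow> nat" where
  "weight p1 m1 p2 j = (if j \<le> m1 then p1 ^ (j - 1) else p1 ^ m1 * p2 ^ (j - m1 - 1))"

definition index :: "nat \<Rightarrow> nat \<Rightarrow> nat \<Rightarrow> nat \<Rightarrow> (nat \<Rightarrow> nat) \<Rightarrow> nat" where
  "index p1 m1 p2 m2 x = (\<Sum>j=1..m1 + m2. x j * weight p1 m1 p2 j)"

lemma index_vec_of:
  assumes "p1 > 0" "p2 > 0" "s < p1 ^ m1 * p2 ^ m2"
  shows "vec_of p1 m1 p2 m2 s \<in> box p1 m1 p2 m2"
    and "index p1 m1 p2 m2 (vec_of p1 m1 p2 m2 s) = s"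
proof -
  let ?x = "vec_of p1 m1 p2 m2 s"
  have *: "?x \<in> box p1 m1 p2 m2"
      "s = (\<Sum>j=1..m1. ?x j * p1 ^ (j - 1)) + p1 ^ m1 * (\<Sum>j=1..m2. ?x (m1 + j) * p2 ^ (j - 1))"
    using vec_of_unique[OF assms, of ?x] by auto
  show "?x \<in> box p1 m1 p2 m2" by (rule *)
  have "index p1 m1 p2 m2 ?x
      = (\<Sum>j=1..m1. ?x j * weight p1 m1 p2 j) + (\<Sum>j=m1 + 1..m1 + m2. ?x j * weight p1 m1 p2 j)"
    unfolding index_def by (rule sum.ub_add_nat) simp
  also have "(\<Sum>j=m1 + 1..m1 + m2. ?x j * weight p1 m1 p2 j)
      = (\<Sum>j=1..m2. ?x (j + m1) * weight p1 m1 p2 (j + m1))"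
    using sum.shift_bounds_cl_nat_ivl[of "\<lambda>j. ?x j * weight p1 m1 p2 j" 1 m1 m2] by (simp add: add.commute)
  also have "\<dots> = p1 ^ m1 * (\<Sum>j=1..m2. ?x (m1 + j) * p2 ^ (j - 1))"
    unfolding sum_distrib_left by (intro sum.cong refl) (simp add: weight_def add.commute)
  also have "(\<Sum>j=1..m1. ?x j * weight p1 m1 p2 j) = (\<Sum>j=1..m1. ?x j * p1 ^ (j - 1))"
    by (intro sum.cong refl) (simp add: weight_def)
  finally show "index p1 m1 p2 m2 ?x = s" using *(2) by simp
qed

lemma finite_box [simp]: "finite (box p1 m1 p2 m2)"
  unfolding box_def by (rule finite_PiE) auto

lemma card_box: "card (box p1 m1 p2 m2) = p1 ^ m1 * p2 ^ m2"
proof -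
  have "card (box p1 m1 p2 m2) = (\<Prod>j=1..m1 + m2. if j \<le> m1 then p1 else p2)"
    unfolding box_def by (subst card_PiE) (auto intro: prod.cong)
  also have "\<dots> = (\<Prod>j=1..m1. if j \<le> m1 then p1 else p2) * (\<Prod>j=m1 + 1..m1 + m2. if j \<le> m1 then p1 else p2)"
    by (rule prod.ub_add_nat) simp
  also have "\<dots> = p1 ^ m1 * p2 ^ m2" by simp
  finally show ?thesis .
qed

lemma bij_betw_vec_of:
  assumes "p1 > 0" "p2 > 0"
  shows "bij_betw (vec_of p1 m1 p2 m2) {..<p1 ^ m1 * p2 ^ m2} (box p1 m1 p2 m2)"
proof -
  have inj: "inj_on (vec_of p1 m1 p2 m2) {..<p1 ^ m1 * p2 ^ m2}"
    by (rule inj_on_inverseI[where g = "index p1 m1 p2 m2"]) (use index_vec_of(2)[OF assms] in auto)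
  moreover have "vec_of p1 m1 p2 m2 ` {..<p1 ^ m1 * p2 ^ m2} = box p1 m1 p2 m2"
    by (rule card_subset_eq)
      (use index_vec_of(1)[OF assms] in \<open>auto simp: card_image[OF inj] card_box\<close>)
  ultimately show ?thesis by (simp add: bij_betw_def)
qed

lemma inj_on_index:
  assumes "p1 > 0" "p2 > 0"
  shows "inj_on (index p1 m1 p2 m2) (box p1 m1 p2 m2)"
proof (rule inj_onI)
  fix x y assume xy: "x \<in> box p1 m1 p2 m2" "y \<in> box p1 m1 p2 m2"
    and eq: "index p1 m1 p2 m2 x = index p1 m1 p2 m2 y"
  have "box p1 m1 p2 m2 = vec_of p1 m1 p2 m2 ` {..<p1 ^ m1 * p2 ^ m2}"
    using bij_betw_imp_surj_on[OF bij_betw_vec_of[OF assms]] by simp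
  then obtain s s' where "x = vec_of p1 m1 p2 m2 s" "s < p1 ^ m1 * p2 ^ m2"
      "y = vec_of p1 m1 p2 m2 s'" "s' < p1 ^ m1 * p2 ^ m2"
    using xy by auto
  with eq index_vec_of(2)[OF assms] show "x = y" by simp
qed

lemma spectrum_seq_of:
  assumes "p1 > 0" "p2 > 0"
  shows "spectrum (p1 ^ m1 * p2 ^ m2) (seq_of q p1 m1 p2 m2 F) \<theta>
    = (\<Sum>x\<in>box p1 m1 p2 m2. \<xi> q ^ F x * cis (\<theta> * real (index p1 m1 p2 m2 x)))"
proof -
  have "(\<Sum>x\<in>box p1 m1 p2 m2. \<xi> q ^ F x * cis (\<theta> * real (index p1 m1 p2 m2 x)))
      = (\<Sum>s<p1 ^ m1 * p2 ^ m2. \<xi> q ^ F (vec_of p1 m1 p2 m2 s) *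
          cis (\<theta> * real (index p1 m1 p2 m2 (vec_of p1 m1 p2 m2 s))))"
    by (rule sum.reindex_bij_betw[OF bij_betw_vec_of[OF assms], symmetric])
  then show ?thesis
    using index_vec_of(2)[OF assms] by (simp add: spectrum_def seq_of_def)
qed

section \<open>Splitting a point into restricted variables and two paths\<close>

lemma sum_split_bij:
  assumes "bij_betw j {1..n} J" "bij_betw \<tau> {1..N} (A - J)" "J \<subseteq> A" "finite A"
  shows "(\<Sum>i\<in>A. h i) = (\<Sum>v=1..n. h (j v)) + (\<Sum>i=1..N. h (\<tau> i))"
proof -
  have "(\<Sum>i\<in>A. h i) = (\<Sum>i\<in>A - J. h i) + (\<Sum>i\<in>J. h i)"
    by (rule sum.subset_diff) (use assms in auto)
  then show ?thesis
    using sum.reindex_bij_betw[OF assms(1), of h] sum.reindex_bij_betw[OF assms(2), of h]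
    by (simp add: add.commute)
qed

lemma box_less:
  assumes "x \<in> box p1 m1 p2 m2"
  shows "j \<in> {1..m1} \<Longrightarrow> x j < p1" "j \<in> {m1 + 1..m1 + m2} \<Longrightarrow> x j < p2"
proof -
  have *: "x j \<in> (if j \<le> m1 then {..<p1} else {..<p2})" if "j \<in> {1..m1 + m2}"
    by (rule PiE_mem[where T = "\<lambda>j. if j \<le> m1 then {..<p1} else {..<p2}", OF _ that])
      (use assms in \<open>unfold box_def, blast\<close>)
  show "j \<in> {1..m1} \<Longrightarrow> x j < p1" "j \<in> {m1 + 1..m1 + m2} \<Longrightarrow> x j < p2" using * by auto
qed

lemma subvec_eqD: "subvec a n x = subvec a n y \<Longrightarrow> i \<in> {1..n} \<Longrightarrow> x (a i) = y (a i)"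
  unfolding subvec_def by (drule fun_cong[of _ _ i]) simp

lemma subvec_Zvec: "(\<And>i. i \<in> {1..n} \<Longrightarrow> x (a i) < p) \<Longrightarrow> subvec a n x \<in> Zvec p n"
  by (auto simp: subvec_def Zvec_def)

lemma subvec_box:
  assumes x: "x \<in> box p1 m1 p2 m2" and j: "bij_betw j {1..n} J"
  shows "J \<subseteq> {1..m1} \<Longrightarrow> subvec j n x \<in> Zvec p1 n"
    and "J \<subseteq> {m1 + 1..m1 + m2} \<Longrightarrow> subvec j n x \<in> Zvec p2 n"
  using bij_betwE[OF j] by (blast intro: subvec_Zvec box_less[OF x])+

text \<open>Every variable is listed by one of \<open>j1\<close>, \<open>\<tau>1\<close>,
  \<open>j2\<close>, \<open>\<tau>2\<close>, which gives injectivity; surjectivity follows by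
  counting.\<close>

lemma bij_betw_box_split:
  assumes j1: "bij_betw j1 {1..n1} J1" and t1: "bij_betw \<tau>1 {1..N1} ({1..m1} - J1)"
    and J1: "J1 \<subseteq> {1..m1}"
    and j2: "bij_betw j2 {1..n2} J2" and t2: "bij_betw \<tau>2 {1..N2} ({m1 + 1..m1 + m2} - J2)"
    and J2: "J2 \<subseteq> {m1 + 1..m1 + m2}"
  shows "bij_betw (\<lambda>x. (subvec j1 n1 x, subvec \<tau>1 N1 x, subvec j2 n2 x, subvec \<tau>2 N2 x))
    (box p1 m1 p2 m2) (Zvec p1 n1 \<times> Zvec p1 N1 \<times> Zvec p2 n2 \<times> Zvec p2 N2)"
    (is "bij_betw ?\<Phi> ?X ?Y")
proof -
  have inj: "inj_on ?\<Phi> ?X"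
  proof (rule inj_onI)
    fix x y assume xy: "x \<in> ?X" "y \<in> ?X" and eq: "?\<Phi> x = ?\<Phi> y"
    show "x = y"
    proof (rule PiE_ext[OF xy[unfolded box_def]])
      fix j assume j: "j \<in> {1..m1 + m2}"
      then consider "j \<in> J1" | "j \<in> {1..m1} - J1" | "j \<in> J2" | "j \<in> {m1 + 1..m1 + m2} - J2"
        by fastforce
      then show "x j = y j"
      proof cases
        case 1
        then have "j \<in> j1 ` {1..n1}" using bij_betw_imp_surj_on[OF j1] by simp
        then obtain i where "i \<in> {1..n1}" "j = j1 i" by blast
        then show ?thesis using eq subvec_eqD[of j1 n1 x y] by auto
      next
        case 2
        then have "j \<in> \<tau>1 ` {1..N1}" using bij_betw_imp_surj_on[OF t1] by simp
        then obtain i where "i \<in> {1..N1}" "j = \<tau>1 i" by blast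
        then show ?thesis using eq subvec_eqD[of \<tau>1 N1 x y] by auto
      next
        case 3
        then have "j \<in> j2 ` {1..n2}" using bij_betw_imp_surj_on[OF j2] by simp
        then obtain i where "i \<in> {1..n2}" "j = j2 i" by blast
        then show ?thesis using eq subvec_eqD[of j2 n2 x y] by auto
      next
        case 4
        then have "j \<in> \<tau>2 ` {1..N2}" using bij_betw_imp_surj_on[OF t2] by simp
        then obtain i where "i \<in> {1..N2}" "j = \<tau>2 i" by blast
        then show ?thesis using eq subvec_eqD[of \<tau>2 N2 x y] by auto
      qed
    qed
  qed
  moreover have "?\<Phi> ` ?X = ?Y"
  proof (rule card_subset_eq)
    show "?\<Phi> ` ?X \<subseteq> ?Y"
    proof (rule image_subsetI)
      fix x assume x: "x \<in> ?X"
      show "?\<Phi> x \<in> ?Y"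
        using subvec_box[OF x j1] subvec_box[OF x t1] subvec_box[OF x j2] subvec_box[OF x t2] J1 J2
        by blast
    qed
    \<comment> \<open>With the constant summand 1, splitting a sum counts the variables.\<close>
    have "card {1..m1} = n1 + N1"
      using sum_split_bij[OF j1 t1 J1, of "\<lambda>_. 1::nat"] by simp
    moreover have "card {m1 + 1..m1 + m2} = n2 + N2"
      using sum_split_bij[OF j2 t2 J2, of "\<lambda>_. 1::nat"] by simp
    ultimately have "m1 = n1 + N1" "m2 = n2 + N2" by auto
    then show "card (?\<Phi> ` ?X) = card ?Y"
      unfolding card_image[OF inj] card_box by (simp add: power_add)
  qed simp
  ultimately show ?thesis by (simp add: bij_betw_def)
qed

text \<open>Applied to the previous bijection, this parametrises the points with prescribed
  restricted variables by independent pairs of paths.\<close>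

lemma bij_betw_fibre:
  assumes \<Phi>: "bij_betw (\<lambda>x. (a x, b x, c x, d x)) X (A \<times> B \<times> C \<times> D)"
    and "c1 \<in> A" "c2 \<in> C"
  shows "bij_betw (\<lambda>x. (b x, d x)) {x\<in>X. a x = c1 \<and> c x = c2} (B \<times> D)"
  unfolding bij_betw_def
proof
  show "inj_on (\<lambda>x. (b x, d x)) {x\<in>X. a x = c1 \<and> c x = c2}"
    using bij_betw_imp_inj_on[OF \<Phi>] by (auto simp: inj_on_def)
  have *: "(\<lambda>x. (a x, b x, c x, d x)) ` X = A \<times> B \<times> C \<times> D"
    using \<Phi> by (rule bij_betw_imp_surj_on)
  show "(\<lambda>x. (b x, d x)) ` {x\<in>X. a x = c1 \<and> c x = c2} = B \<times> D"
  proof safe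
    fix x assume "x \<in> X"
    then have "(a x, b x, c x, d x) \<in> A \<times> B \<times> C \<times> D" using * by blast
    then show "b x \<in> B" "d x \<in> D" by auto
  next
    fix y z assume "y \<in> B" "z \<in> D"
    then have "(c1, y, c2, z) \<in> (\<lambda>x. (a x, b x, c x, d x)) ` X" unfolding * using assms by simp
    then show "(y, z) \<in> (\<lambda>x. (b x, d x)) ` {x\<in>X. a x = c1 \<and> c x = c2}" by auto
  qed
qed

lemma index_split:
  assumes j1: "bij_betw j1 {1..n1} J1" and t1: "bij_betw \<tau>1 {1..N1} ({1..m1} - J1)"
    and J1: "J1 \<subseteq> {1..m1}"
    and j2: "bij_betw j2 {1..n2} J2" and t2: "bij_betw \<tau>2 {1..N2} ({m1 + 1..m1 + m2} - J2)"
    and J2: "J2 \<subseteq> {m1 + 1..m1 + m2}"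
  shows "index p1 m1 p2 m2 x =
    ((\<Sum>v=1..n1. subvec j1 n1 x v * weight p1 m1 p2 (j1 v))
      + (\<Sum>v=1..n2. subvec j2 n2 x v * weight p1 m1 p2 (j2 v)))
    + (\<Sum>i=1..N1. subvec \<tau>1 N1 x i * weight p1 m1 p2 (\<tau>1 i))
    + (\<Sum>i=1..N2. subvec \<tau>2 N2 x i * weight p1 m1 p2 (\<tau>2 i))"
proof -
  have "index p1 m1 p2 m2 x = (\<Sum>j=1..m1. x j * weight p1 m1 p2 j)
      + (\<Sum>j=m1 + 1..m1 + m2. x j * weight p1 m1 p2 j)"
    unfolding index_def by (rule sum.ub_add_nat) simp
  then show ?thesis
    unfolding sum_split_bij[OF j1 t1 J1 finite_atLeastAtMost] sum_split_bij[OF j2 t2 J2 finite_atLeastAtMost]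
    by (simp add: subvec_def)
qed

lemma sum_rearrange:
  "(\<Sum>a\<in>A. \<Sum>b\<in>B. \<Sum>c\<in>C. \<Sum>d\<in>D. h a b c d) = (\<Sum>c\<in>C. \<Sum>a\<in>A. \<Sum>d\<in>D. \<Sum>b\<in>B. h a b c d)"
proof -
  have "(\<Sum>a\<in>A. \<Sum>b\<in>B. \<Sum>c\<in>C. \<Sum>d\<in>D. h a b c d) = (\<Sum>a\<in>A. \<Sum>c\<in>C. \<Sum>b\<in>B. \<Sum>d\<in>D. h a b c d)"
    by (intro sum.cong refl, rule sum.swap)
  also have "\<dots> = (\<Sum>c\<in>C. \<Sum>a\<in>A. \<Sum>b\<in>B. \<Sum>d\<in>D. h a b c d)" by (rule sum.swap)
  also have "\<dots> = (\<Sum>c\<in>C. \<Sum>a\<in>A. \<Sum>d\<in>D. \<Sum>b\<in>B. h a b c d)"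
    by (intro sum.cong refl, rule sum.swap)
  finally show ?thesis .
qed

section \<open>Characters and the numbering of the codes\<close>

text \<open>The character table of \<open>\<int>\<^sub>p\<^sub>1\<^bsup>n1+1\<^esup> \<times> \<int>\<^sub>p\<^sub>2\<^bsup>n2+1\<^esup>\<close>.\<close>

definition chi ::
  "nat \<Rightarrow> nat \<Rightarrow> nat \<Rightarrow> nat \<Rightarrow> (nat \<Rightarrow> nat) \<times> nat \<times> (nat \<Rightarrow> nat) \<times> nat \<Rightarrow>
    (nat \<Rightarrow> nat) \<times> nat \<times> (nat \<Rightarrow> nat) \<times> nat \<Rightarrow> complex" where
  "chi p1 n1 p2 n2 = (\<lambda>(d1, e1, d2, e2) (c1, u, c2, v).
    \<xi> p1 ^ (\<Sum>i=1..n1. d1 i * c1 i) * (\<xi> p1 ^ (e1 * u) *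
      (\<xi> p2 ^ (\<Sum>i=1..n2. d2 i * c2 i) * \<xi> p2 ^ (e2 * v))))"

lemma chi_commute: "chi p1 n1 p2 n2 d c = chi p1 n1 p2 n2 c d"
  by (simp add: chi_def case_prod_unfold mult.commute)

lemma orth_rows_chi:
  "orth_rows (Zvec p1 n1 \<times> {..<p1} \<times> Zvec p2 n2 \<times> {..<p2}) (Zvec p1 n1 \<times> {..<p1} \<times> Zvec p2 n2 \<times> {..<p2})
    (of_nat (p1 ^ (n1 + 1) * p2 ^ (n2 + 1))) (chi p1 n1 p2 n2)"
proof -
  have "orth_rows (Zvec p1 n1 \<times> {..<p1} \<times> Zvec p2 n2 \<times> {..<p2}) (Zvec p1 n1 \<times> {..<p1} \<times> Zvec p2 n2 \<times> {..<p2})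
    (of_nat (p1 ^ n1) * (of_nat p1 * (of_nat (p2 ^ n2) * of_nat p2)))
    (\<lambda>(i, i') (k, k'). \<xi> p1 ^ (\<Sum>v=1..n1. i v * k v) *
      (\<lambda>(i, i') (k, k'). \<xi> p1 ^ (i * k) * (\<lambda>(i, i') (k, k'). \<xi> p2 ^ (\<Sum>v=1..n2. i v * k v) * \<xi> p2 ^ (i' * k')) i' k') i' k')"
    by (intro orth_rows_prod orth_rows_Zvec orth_rows_xi)
  then show ?thesis by (simp add: chi_def case_prod_unfold ac_simps)
qed

text \<open>The remainder and the quotient are the numbers \<open>t1\<close> and \<open>t2\<close>
  of the theorem. The top digit of each stands apart because it multiplies the end of a path; the
  tuple has the shape of an index \<open>d\<close>, so one character table serves both
  \<open>t\<close> and \<open>d\<close>.\<close>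

definition digits :: "nat \<Rightarrow> nat \<Rightarrow> nat \<Rightarrow> nat \<Rightarrow> nat \<Rightarrow> (nat \<Rightarrow> nat) \<times> nat \<times> (nat \<Rightarrow> nat) \<times> nat" where
  "digits p1 n1 p2 n2 t =
    (\<lambda>v\<in>{1..n1}. digit p1 (t mod p1 ^ (n1 + 1)) v, digit p1 (t mod p1 ^ (n1 + 1)) (n1 + 1),
     \<lambda>v\<in>{1..n2}. digit p2 (t div p1 ^ (n1 + 1)) v, digit p2 (t div p1 ^ (n1 + 1)) (n2 + 1))"

lemma digits_mem:
  assumes "p1 > 0" "p2 > 0"
  shows "digits p1 n1 p2 n2 t \<in> Zvec p1 n1 \<times> {..<p1} \<times> Zvec p2 n2 \<times> {..<p2}"
  using assms by (auto simp: digits_def Zvec_def digit_def)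

lemma digit_inj:
  assumes "s < p ^ (n + 1)" "t < p ^ (n + 1)"
    and eq: "(\<lambda>v\<in>{1..n}. digit p s v) = (\<lambda>v\<in>{1..n}. digit p t v)" "digit p s (n + 1) = digit p t (n + 1)"
  shows "s = t"
proof -
  have "digit p s v = digit p t v" if "v \<in> {1..n + 1}" for v
    using fun_cong[OF eq(1), of v] eq(2) that by (cases "v = n + 1") auto
  then have "undigits p (n + 1) (digit p s) = undigits p (n + 1) (digit p t)"
    unfolding undigits_def by (intro sum.cong) auto
  then show ?thesis unfolding undigits_digit[OF assms(1)] undigits_digit[OF assms(2)] .
qed

lemma inj_on_digits:
  assumes "p1 > 0" "p2 > 0"
  shows "inj_on (digits p1 n1 p2 n2) {..<p1 ^ (n1 + 1) * p2 ^ (n2 + 1)}"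
proof (rule inj_onI)
  fix s t assume st: "s \<in> {..<p1 ^ (n1 + 1) * p2 ^ (n2 + 1)}" "t \<in> {..<p1 ^ (n1 + 1) * p2 ^ (n2 + 1)}"
    and eq: "digits p1 n1 p2 n2 s = digits p1 n1 p2 n2 t"
  let ?P = "p1 ^ (n1 + 1)"
  have "s mod ?P = t mod ?P"
    by (rule digit_inj[of _ p1 n1]) (use eq assms in \<open>auto simp: digits_def\<close>)
  moreover have "s div ?P = t div ?P"
    by (rule digit_inj[of _ p2 n2]) (use eq st assms in \<open>auto simp: digits_def less_mult_imp_div_less mult.commute\<close>)
  ultimately show "s = t" by (metis div_mult_mod_eq)
qed

section \<open>The codes of the theorem\<close>

text \<open>The hypotheses in the form used by the computation: the listings of the free variables
  are bijections, and \<open>f\<close> is given at each point through the label of that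
  point.\<close>

locale ccc_family =
  fixes p1 p2 q m1 m2 n1 n2 lam :: nat
    and J1 J2 :: "nat set"
    and j1 j2 :: "nat \<Rightarrow> nat"
    and fs fs' hs hs' gs gs' :: "nat \<Rightarrow> nat \<Rightarrow> nat"
    and f0 h0 :: "nat \<Rightarrow> nat"
    and \<pi> \<pi>' :: "nat \<Rightarrow> nat \<Rightarrow> nat"
    and f :: "(nat \<Rightarrow> nat) \<Rightarrow> nat"
    and C :: "nat \<Rightarrow> (nat \<Rightarrow> nat) \<times> nat \<times> (nat \<Rightarrow> nat) \<times> nat \<Rightarrow> (nat \<Rightarrow> nat) \<Rightarrow> nat"
  assumes p: "p1 > 0" "p2 > 0" and q: "q = p1 * p2"
    and n: "n1 < m1" "n2 < m2"
    and J1: "J1 \<subseteq> {1..m1}" "bij_betw j1 {1..n1} J1"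
    and J2: "J2 \<subseteq> {m1 + 1..m1 + m2}" "bij_betw j2 {1..n2} J2"
    and \<pi>: "\<And>c. c < p1 ^ n1 * p2 ^ n2 \<Longrightarrow> bij_betw (\<pi> c) {1..m1 - n1} ({1..m1} - J1)"
    and \<pi>': "\<And>c. c < p1 ^ n1 * p2 ^ n2 \<Longrightarrow>
      bij_betw (\<pi>' c) {1..m2 - n2} ({m1 + 1..m1 + m2} - J2)"
    and f: "\<And>c x. x \<in> box p1 m1 p2 m2 \<Longrightarrow>
      c = label p1 n1 p2 n2 (subvec j1 n1 x) (subvec j2 n2 x) \<Longrightarrow>
      f x = ((q div p1) * (\<Sum>i=1..m1 - n1 - 1. fs i (x (\<pi> c i)) * fs' i (x (\<pi> c (i + 1))))
             + (\<Sum>\<alpha>=1..m1 - n1. gs \<alpha> (x (\<pi> c \<alpha>)))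
             + (q div p2) * (\<Sum>j=1..m2 - n2 - 1. hs j (x (\<pi>' c j)) * hs' j (x (\<pi>' c (j + 1))))
             + (\<Sum>\<beta>=1..m2 - n2. gs' \<beta> (x (\<pi>' c \<beta>)))
             + lam * f0 (x (\<pi> c (m1 - n1))) * h0 (x (\<pi>' c 1))) mod q"
    and C: "\<And>t t1 t2 d1 e1 d2 e2 c x.
      t1 < p1 ^ (n1 + 1) \<Longrightarrow> t2 < p2 ^ (n2 + 1) \<Longrightarrow> t = t2 * p1 ^ (n1 + 1) + t1 \<Longrightarrow>
      d1 \<in> Zvec p1 n1 \<Longrightarrow> e1 \<in> {..<p1} \<Longrightarrow> d2 \<in> Zvec p2 n2 \<Longrightarrow> e2 \<in> {..<p2} \<Longrightarrow>
      x \<in> box p1 m1 p2 m2 \<Longrightarrow> c = label p1 n1 p2 n2 (subvec j1 n1 x) (subvec j2 n2 x) \<Longrightarrow>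
      C t (d1, e1, d2, e2) x =
        (f x
         + (q div p1) * (\<Sum>v=1..n1. (d1 v + digit p1 t1 v) * subvec j1 n1 x v)
         + (q div p2) * (\<Sum>v=1..n2. (d2 v + digit p2 t2 v) * subvec j2 n2 x v)
         + (q div p1) * (e1 * x (\<pi> c 1) + digit p1 t1 (n1 + 1) * x (\<pi> c (m1 - n1)))
         + (q div p2) * (e2 * x (\<pi>' c 1) + digit p2 t2 (n2 + 1) * x (\<pi>' c (m2 - n2)))) mod q"
begin

abbreviation "N1 \<equiv> m1 - n1"
abbreviation "N2 \<equiv> m2 - n2"
abbreviation "M \<equiv> p1 ^ (n1 + 1) * p2 ^ (n2 + 1)"
abbreviation "L \<equiv> p1 ^ m1 * p2 ^ m2"
abbreviation "I \<equiv> Zvec p1 n1 \<times> {..<p1} \<times> Zvec p2 n2 \<times> {..<p2}"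
abbreviation "W \<equiv> weight p1 m1 p2"

section \<open>The factors of the matrix of spectra\<close>

definition edge1 :: "nat \<Rightarrow> nat \<Rightarrow> nat \<Rightarrow> complex" where
  "edge1 i u v = \<xi> p1 ^ (fs i u * fs' i v)"

definition edge2 :: "nat \<Rightarrow> nat \<Rightarrow> nat \<Rightarrow> complex" where
  "edge2 i u v = \<xi> p2 ^ (hs i u * hs' i v)"

text \<open>The phase at \<theta> of a free variable is stored in its vertex weight, so \<theta>
  affects only the diagonal factors of the chain and never the edges.\<close>

definition vertex1 :: "nat \<Rightarrow> real \<Rightarrow> nat \<Rightarrow> nat \<Rightarrow> complex" where
  "vertex1 c \<theta> i u = \<xi> q ^ gs i u * cis (\<theta> * real (u * W (\<pi> c i)))"

definition vertex2 :: "nat \<Rightarrow> real \<Rightarrow> nat \<Rightarrow> nat \<Rightarrow> complex" where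
  "vertex2 c \<theta> i u = \<xi> q ^ gs' i u * cis (\<theta> * real (u * W (\<pi>' c i)))"

definition link :: "nat \<Rightarrow> nat \<Rightarrow> complex" where
  "link a v = \<xi> q ^ (lam * f0 a * h0 v)"

definition base :: "real \<Rightarrow> (nat \<Rightarrow> nat) \<Rightarrow> (nat \<Rightarrow> nat) \<Rightarrow> complex" where
  "base \<theta> c1 c2 = cis (\<theta> * real ((\<Sum>v=1..n1. c1 v * W (j1 v)) + (\<Sum>v=1..n2. c2 v * W (j2 v))))"

abbreviation lab :: "(nat \<Rightarrow> nat) \<Rightarrow> (nat \<Rightarrow> nat) \<Rightarrow> nat" where
  "lab \<equiv> label p1 n1 p2 n2"

text \<open>The matrix \<open>(Q \<otimes> 1) \<Lambda> (1 \<otimes> P)\<close>: rows are the first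
  vertices of the two paths, columns the last ones, and \<open>link\<close> joins the end of the
  first path to the start of the second.\<close>

definition kernel :: "real \<Rightarrow> (nat \<Rightarrow> nat) \<Rightarrow> (nat \<Rightarrow> nat) \<Rightarrow> nat \<times> nat \<Rightarrow> nat \<times> nat \<Rightarrow> complex" where
  "kernel \<theta> c1 c2 = (\<lambda>(u, v) (a, b).
    chain p1 N1 (vertex1 (lab c1 c2) \<theta>) edge1 u a * link a v *
    chain p2 N2 (vertex2 (lab c1 c2) \<theta>) edge2 v b)"

definition block :: "real \<Rightarrow> (nat \<Rightarrow> nat) \<times> nat \<times> (nat \<Rightarrow> nat) \<times> nat \<Rightarrow>
    (nat \<Rightarrow> nat) \<times> nat \<times> (nat \<Rightarrow> nat) \<times> nat \<Rightarrow> complex" where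
  "block \<theta> = (\<lambda>(c1, u, c2, v) (b1, a, b2, b).
    if c1 = b1 \<and> c2 = b2 then base \<theta> c1 c2 * kernel \<theta> c1 c2 (u, v) (a, b) else 0)"

lemma xi_q_1: "\<xi> q ^ ((q div p1) * k) = \<xi> p1 ^ k"
  using xi_power_mult[of p2 p1 k] p by (simp add: q mult.commute)

lemma xi_q_2: "\<xi> q ^ ((q div p2) * k) = \<xi> p2 ^ k"
  using xi_power_mult[of p1 p2 k] p by (simp add: q)

lemma xi_f:
  assumes x: "x \<in> box p1 m1 p2 m2" and c: "c = lab (subvec j1 n1 x) (subvec j2 n2 x)"
    and y: "y = subvec (\<pi> c) N1 x" and z: "z = subvec (\<pi>' c) N2 x"
  shows "\<xi> q ^ f x = path_weight N1 (\<lambda>i u. \<xi> q ^ gs i u) edge1 y *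
    path_weight N2 (\<lambda>i u. \<xi> q ^ gs' i u) edge2 z * link (y N1) (z 1)"
proof -
  have yi: "x (\<pi> c i) = y i" if "i \<in> {1..N1}" for i using that by (simp add: y subvec_def)
  have zi: "x (\<pi>' c i) = z i" if "i \<in> {1..N2}" for i using that by (simp add: z subvec_def)
  have 1: "(\<Sum>i=1..N1 - 1. fs i (x (\<pi> c i)) * fs' i (x (\<pi> c (i + 1))))
      = (\<Sum>i=1..N1 - 1. fs i (y i) * fs' i (y (i + 1)))"
    using yi by (intro sum.cong) auto
  have 2: "(\<Sum>\<alpha>=1..N1. gs \<alpha> (x (\<pi> c \<alpha>))) = (\<Sum>\<alpha>=1..N1. gs \<alpha> (y \<alpha>))"
    using yi by (intro sum.cong) auto
  have 3: "(\<Sum>i=1..N2 - 1. hs i (x (\<pi>' c i)) * hs' i (x (\<pi>' c (i + 1))))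
      = (\<Sum>i=1..N2 - 1. hs i (z i) * hs' i (z (i + 1)))"
    using zi by (intro sum.cong) auto
  have 4: "(\<Sum>\<beta>=1..N2. gs' \<beta> (x (\<pi>' c \<beta>))) = (\<Sum>\<beta>=1..N2. gs' \<beta> (z \<beta>))"
    using zi by (intro sum.cong) auto
  have 5: "x (\<pi> c N1) = y N1" "x (\<pi>' c 1) = z 1" using n by (auto intro: yi zi)
  show ?thesis
    unfolding f[OF x c] xi_power_mod 1 2 3 4 5 power_add xi_q_1 xi_q_2
    by (simp add: path_weight_def edge1_def edge2_def link_def power_sum)
qed

text \<open>Both \<open>t\<close> and \<open>d\<close> weight the restricted variables, but
  \<open>t\<close> weights the last vertices of the paths and \<open>d\<close> the first ones. The
  added terms therefore give a product of two characters at different arguments.\<close>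

lemma xi_C:
  assumes t: "t < M" and d: "d \<in> I" and x: "x \<in> box p1 m1 p2 m2"
    and c1: "c1 = subvec j1 n1 x" and c2: "c2 = subvec j2 n2 x"
    and y: "y = subvec (\<pi> (lab c1 c2)) N1 x" and z: "z = subvec (\<pi>' (lab c1 c2)) N2 x"
  shows "\<xi> q ^ C t d x = \<xi> q ^ f x *
    (chi p1 n1 p2 n2 (digits p1 n1 p2 n2 t) (c1, y N1, c2, z N2) * chi p1 n1 p2 n2 d (c1, y 1, c2, z 1))"
proof -
  obtain d1 e1 d2 e2 where d': "d = (d1, e1, d2, e2)" "d1 \<in> Zvec p1 n1" "e1 \<in> {..<p1}"
      "d2 \<in> Zvec p2 n2" "e2 \<in> {..<p2}" using d by auto
  define t1 t2 where "t1 = t mod p1 ^ (n1 + 1)" and "t2 = t div p1 ^ (n1 + 1)"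
  have t12: "t1 < p1 ^ (n1 + 1)" "t2 < p2 ^ (n2 + 1)" "t = t2 * p1 ^ (n1 + 1) + t1"
    using p t by (auto simp: t1_def t2_def less_mult_imp_div_less mult.commute)
  have ends: "x (\<pi> (lab c1 c2) 1) = y 1" "x (\<pi> (lab c1 c2) N1) = y N1"
      "x (\<pi>' (lab c1 c2) 1) = z 1" "x (\<pi>' (lab c1 c2) N2) = z N2"
    using n by (auto simp: y z subvec_def)
  have "\<xi> q ^ C t d x = \<xi> q ^ f x
      * \<xi> p1 ^ (\<Sum>v=1..n1. (d1 v + digit p1 t1 v) * c1 v)
      * \<xi> p2 ^ (\<Sum>v=1..n2. (d2 v + digit p2 t2 v) * c2 v)
      * \<xi> p1 ^ (e1 * y 1 + digit p1 t1 (n1 + 1) * y N1)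
      * \<xi> p2 ^ (e2 * z 1 + digit p2 t2 (n2 + 1) * z N2)"
    unfolding d'(1) C[OF t12 d'(2-5) x refl] c1[symmetric] c2[symmetric] ends
      xi_power_mod power_add[of "\<xi> q"] xi_q_1 xi_q_2 ..
  also have "\<dots> = \<xi> q ^ f x *
    (chi p1 n1 p2 n2 (digits p1 n1 p2 n2 t) (c1, y N1, c2, z N2) * chi p1 n1 p2 n2 d (c1, y 1, c2, z 1))"
    unfolding chi_def digits_def d'(1) prod.case t1_def[symmetric] t2_def[symmetric]
    by (simp add: add_mult_distrib sum.distrib power_add)
  finally show ?thesis .
qed

text \<open>Points are grouped by their restricted variables, each fibre is a product of two path
  spaces, and \<open>sum_Zvec_ends\<close> contracts both paths. The outcome is a matrix product:
  character table, transposed block matrix, character table.\<close>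

lemma spectrum_C:
  assumes t: "t < M" and d: "d \<in> I"
  shows "spectrum L (seq_of q p1 m1 p2 m2 (C t d)) \<theta>
    = (\<Sum>E\<in>I. chi p1 n1 p2 n2 (digits p1 n1 p2 n2 t) E * (\<Sum>S\<in>I. block \<theta> S E * chi p1 n1 p2 n2 S d))"
proof -
  let ?X = "box p1 m1 p2 m2"
  let ?\<chi> = "chi p1 n1 p2 n2" and ?t = "digits p1 n1 p2 n2 t"
  let ?Q = "\<lambda>c1 c2. chain p1 N1 (vertex1 (lab c1 c2) \<theta>) edge1"
  let ?P = "\<lambda>c1 c2. chain p2 N2 (vertex2 (lab c1 c2) \<theta>) edge2"
  \<comment> \<open>Everything that depends only on the four end points, so that both path sums can
    be contracted around it.\<close>
  define g where "g c1 c2 u a v b = link a v * (?\<chi> ?t (c1, a, c2, b) * ?\<chi> (c1, u, c2, v) d)"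
    for c1 c2 u a v b
  define T where "T x = \<xi> q ^ C t d x * cis (\<theta> * real (index p1 m1 p2 m2 x))" for x
  have fibre: "(\<Sum>x\<in>{x\<in>?X. subvec j1 n1 x = c1 \<and> subvec j2 n2 x = c2}. T x)
      = base \<theta> c1 c2 * (\<Sum>u<p1. \<Sum>a<p1. \<Sum>v<p2. \<Sum>b<p2. ?Q c1 c2 u a * ?P c1 c2 v b * g c1 c2 u a v b)"
    if c: "c1 \<in> Zvec p1 n1" "c2 \<in> Zvec p2 n2" for c1 c2
  proof -
    let ?c = "lab c1 c2"
    have lc: "?c < p1 ^ n1 * p2 ^ n2" by (rule label_less[OF c])
    note split = J1(2) \<pi>[OF lc] J1(1) J2(2) \<pi>'[OF lc] J2(1)
    have T: "T x = base \<theta> c1 c2 *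
        (path_weight N1 (vertex1 ?c \<theta>) edge1 y * (path_weight N2 (vertex2 ?c \<theta>) edge2 z *
          g c1 c2 (y 1) (y N1) (z 1) (z N2)))"
      if x: "x \<in> ?X" "subvec j1 n1 x = c1" "subvec j2 n2 x = c2"
        and y: "y = subvec (\<pi> ?c) N1 x" and z: "z = subvec (\<pi>' ?c) N2 x" for x y z
    proof -
      have "cis (\<theta> * real (index p1 m1 p2 m2 x)) = base \<theta> c1 c2 *
          cis (\<theta> * real (\<Sum>i=1..N1. y i * W (\<pi> ?c i))) * cis (\<theta> * real (\<Sum>i=1..N2. z i * W (\<pi>' ?c i)))"
        unfolding index_split[OF split] x y z base_def cis_mult of_nat_add distrib_left ..
      moreover have "\<xi> q ^ C t d x = path_weight N1 (\<lambda>i u. \<xi> q ^ gs i u) edge1 y *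
          path_weight N2 (\<lambda>i u. \<xi> q ^ gs' i u) edge2 z * g c1 c2 (y 1) (y N1) (z 1) (z N2)"
        using xi_f[OF x(1) refl, unfolded x, OF y z] xi_C[OF t d x(1) x(2,3)[symmetric] y z]
        by (simp add: g_def chi_commute[of _ _ _ _ d])
      ultimately show ?thesis
        unfolding T_def vertex1_def[abs_def] vertex2_def[abs_def] path_weight_cis by simp
    qed
    have "(\<Sum>x\<in>{x\<in>?X. subvec j1 n1 x = c1 \<and> subvec j2 n2 x = c2}. T x)
        = (\<Sum>x\<in>{x\<in>?X. subvec j1 n1 x = c1 \<and> subvec j2 n2 x = c2}.
            (\<lambda>(y, z). base \<theta> c1 c2 *
              (path_weight N1 (vertex1 ?c \<theta>) edge1 y * (path_weight N2 (vertex2 ?c \<theta>) edge2 z *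
                g c1 c2 (y 1) (y N1) (z 1) (z N2)))) (subvec (\<pi> ?c) N1 x, subvec (\<pi>' ?c) N2 x))"
      unfolding prod.case by (intro sum.cong refl T) auto
    also have "\<dots> = (\<Sum>(y, z)\<in>Zvec p1 N1 \<times> Zvec p2 N2. base \<theta> c1 c2 *
              (path_weight N1 (vertex1 ?c \<theta>) edge1 y * (path_weight N2 (vertex2 ?c \<theta>) edge2 z *
                g c1 c2 (y 1) (y N1) (z 1) (z N2))))"
      by (rule sum.reindex_bij_betw[OF bij_betw_fibre[OF bij_betw_box_split[OF split] c]])
    also have "\<dots> = base \<theta> c1 c2 * (\<Sum>y\<in>Zvec p1 N1. path_weight N1 (vertex1 ?c \<theta>) edge1 y *
        (\<Sum>z\<in>Zvec p2 N2. path_weight N2 (vertex2 ?c \<theta>) edge2 z * g c1 c2 (y 1) (y N1) (z 1) (z N2)))"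
      unfolding sum.cartesian_product' prod.case sum_distrib_left ..
    also have "\<dots> = base \<theta> c1 c2 * (\<Sum>y\<in>Zvec p1 N1. path_weight N1 (vertex1 ?c \<theta>) edge1 y *
        (\<Sum>v<p2. \<Sum>b<p2. ?P c1 c2 v b * g c1 c2 (y 1) (y N1) v b))"
      using n by (subst sum_Zvec_ends) auto
    also have "\<dots> = base \<theta> c1 c2 * (\<Sum>u<p1. \<Sum>a<p1. ?Q c1 c2 u a *
        (\<Sum>v<p2. \<Sum>b<p2. ?P c1 c2 v b * g c1 c2 u a v b))"
      using n by (subst sum_Zvec_ends[where g = "\<lambda>u a. \<Sum>v<p2. \<Sum>b<p2. ?P c1 c2 v b * g c1 c2 u a v b"]) auto
    finally show ?thesis by (simp add: sum_distrib_left mult.assoc)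
  qed
  have "spectrum L (seq_of q p1 m1 p2 m2 (C t d)) \<theta> = (\<Sum>x\<in>?X. T x)"
    unfolding T_def by (rule spectrum_seq_of[OF p])
  also have "\<dots> = (\<Sum>c\<in>Zvec p1 n1 \<times> Zvec p2 n2. \<Sum>x\<in>{x\<in>?X. (subvec j1 n1 x, subvec j2 n2 x) = c}. T x)"
  proof (rule sum.group[symmetric])
    show "(\<lambda>x. (subvec j1 n1 x, subvec j2 n2 x)) ` ?X \<subseteq> Zvec p1 n1 \<times> Zvec p2 n2"
    proof (rule image_subsetI)
      fix x assume x: "x \<in> ?X"
      show "(subvec j1 n1 x, subvec j2 n2 x) \<in> Zvec p1 n1 \<times> Zvec p2 n2"
        using subvec_box[OF x J1(2)] subvec_box[OF x J2(2)] J1(1) J2(1) by blast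
    qed
  qed auto
  also have "\<dots> = (\<Sum>c1\<in>Zvec p1 n1. \<Sum>c2\<in>Zvec p2 n2. base \<theta> c1 c2 *
      (\<Sum>u<p1. \<Sum>a<p1. \<Sum>v<p2. \<Sum>b<p2. ?Q c1 c2 u a * ?P c1 c2 v b * g c1 c2 u a v b))"
    unfolding sum.cartesian_product' prod.inject by (intro sum.cong refl fibre)
  \<comment> \<open>The last vertices move outwards and the first vertices inwards, towards the
    order of a sum over \<open>E\<close> around a sum over \<open>S\<close>; the zero entries
    outside the blocks are inserted afterwards.\<close>
  also have "\<dots> = (\<Sum>c1\<in>Zvec p1 n1. \<Sum>c2\<in>Zvec p2 n2. \<Sum>a<p1. \<Sum>b<p2. \<Sum>u<p1. \<Sum>v<p2.
      base \<theta> c1 c2 * (?Q c1 c2 u a * ?P c1 c2 v b * g c1 c2 u a v b))"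
    by (intro sum.cong refl, unfold sum_distrib_left, rule sum_rearrange[symmetric])
  also have "\<dots> = (\<Sum>c1\<in>Zvec p1 n1. \<Sum>a<p1. \<Sum>c2\<in>Zvec p2 n2. \<Sum>b<p2. \<Sum>u<p1. \<Sum>v<p2.
      base \<theta> c1 c2 * (?Q c1 c2 u a * ?P c1 c2 v b * g c1 c2 u a v b))"
    by (intro sum.cong refl, rule sum.swap)
  also have "\<dots> = (\<Sum>c1\<in>Zvec p1 n1. \<Sum>a<p1. \<Sum>c2\<in>Zvec p2 n2. \<Sum>b<p2. ?\<chi> ?t (c1, a, c2, b) *
      (\<Sum>b1\<in>Zvec p1 n1. \<Sum>u<p1. \<Sum>b2\<in>Zvec p2 n2. \<Sum>v<p2.
        block \<theta> (b1, u, b2, v) (c1, a, c2, b) * ?\<chi> (b1, u, b2, v) d))"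
  proof (intro sum.cong refl)
    fix c1 a c2 b assume c: "c1 \<in> Zvec p1 n1" "c2 \<in> Zvec p2 n2"
    have "(\<Sum>b1\<in>Zvec p1 n1. \<Sum>u<p1. \<Sum>b2\<in>Zvec p2 n2. \<Sum>v<p2.
        block \<theta> (b1, u, b2, v) (c1, a, c2, b) * ?\<chi> (b1, u, b2, v) d)
        = (\<Sum>b1\<in>Zvec p1 n1. \<Sum>u<p1. \<Sum>b2\<in>Zvec p2 n2. \<Sum>v<p2. if b1 = c1 then if b2 = c2 then
          base \<theta> c1 c2 * (?Q c1 c2 u a * link a v * ?P c1 c2 v b) * ?\<chi> (c1, u, c2, v) d else 0 else 0)"
      by (intro sum.cong refl) (auto simp: block_def kernel_def)
    also have "\<dots> = (\<Sum>u<p1. \<Sum>v<p2.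
        base \<theta> c1 c2 * (?Q c1 c2 u a * link a v * ?P c1 c2 v b) * ?\<chi> (c1, u, c2, v) d)"
      using c by (simp add: sum_if_const sum.delta)
    finally show "(\<Sum>u<p1. \<Sum>v<p2. base \<theta> c1 c2 * (?Q c1 c2 u a * ?P c1 c2 v b * g c1 c2 u a v b))
        = ?\<chi> ?t (c1, a, c2, b) * (\<Sum>b1\<in>Zvec p1 n1. \<Sum>u<p1. \<Sum>b2\<in>Zvec p2 n2. \<Sum>v<p2.
          block \<theta> (b1, u, b2, v) (c1, a, c2, b) * ?\<chi> (b1, u, b2, v) d)"
      by (simp add: g_def sum_distrib_left ac_simps)
  qed
  finally show ?thesis unfolding sum.cartesian_product' .
qed

lemma finite_I: "finite I" and card_I: "card I = M" and I_ne: "I \<noteq> {}"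
proof -
  show "finite I" by simp
  show "card I = M" by (simp add: card_cartesian_product)
  then show "I \<noteq> {}" using p by (metis card.empty mult_is_0 power_not_zero not_gr_zero)
qed

lemma orth_rows_digits:
  "orth_rows {..<M} I (of_nat M) (\<lambda>t. chi p1 n1 p2 n2 (digits p1 n1 p2 n2 t))"
  by (rule orth_rows_reindex[OF orth_rows_chi inj_on_digits[OF p]]) (use digits_mem[OF p] in blast)

lemma norm_base: "cmod (base \<theta> c1 c2) = 1"
  by (simp add: base_def)

lemma norm_link: "cmod (link a v) = 1"
  by (simp add: link_def)

lemma orth_rows_block_iff:
  "orth_rows I I s (block \<theta>) \<longleftrightarrow> (\<forall>c1\<in>Zvec p1 n1. \<forall>c2\<in>Zvec p2 n2.
    orth_rows ({..<p1} \<times> {..<p2}) ({..<p1} \<times> {..<p2}) s (kernel \<theta> c1 c2))"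
  unfolding block_def by (rule orth_rows_block) (simp_all add: norm_base)

lemma spectrum_orth_iff:
  "orth_rows {..<M} I s (\<lambda>t d. spectrum L (seq_of q p1 m1 p2 m2 (C t d)) \<theta>) \<longleftrightarrow>
   orth_rows {..<M} I s (\<lambda>t d. \<Sum>E\<in>I. chi p1 n1 p2 n2 (digits p1 n1 p2 n2 t) E *
     (\<Sum>S\<in>I. block \<theta> S E * chi p1 n1 p2 n2 S d))"
  by (rule orth_rows_cong) (simp only: spectrum_C lessThan_iff)

lemma vertex1_eq: "vertex1 c \<theta> = (\<lambda>i u. \<xi> q ^ gs i u * cis (\<theta> * real (u * W (\<pi> c i))))"
  by (simp add: vertex1_def[abs_def])

lemma vertex2_eq: "vertex2 c \<theta> = (\<lambda>i u. \<xi> q ^ gs' i u * cis (\<theta> * real (u * W (\<pi>' c i))))"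
  by (simp add: vertex2_def[abs_def])

section \<open>Sufficiency of the permutation conditions\<close>

lemma CCC_if_permutes:
  assumes "\<forall>i\<in>{1..N1 - 1}. permutes_mod p1 (fs i) \<and> permutes_mod p1 (fs' i)"
    and "\<forall>j\<in>{1..N2 - 1}. permutes_mod p2 (hs j) \<and> permutes_mod p2 (hs' j)"
  shows "is_CCC I M L (\<lambda>t d. seq_of q p1 m1 p2 m2 (C t d))"
proof -
  let ?s = "of_nat (p1 ^ (N1 - 1)) * of_nat (p2 ^ (N2 - 1)) :: complex"
  have s: "?s \<noteq> 0" using p by simp
  have "orth_rows {..<M} I (of_nat (M * L)) (\<lambda>t d. spectrum L (seq_of q p1 m1 p2 m2 (C t d)) \<theta>)" for \<theta>
  proof -
    have "orth_rows I I ?s (block \<theta>)"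
      unfolding orth_rows_block_iff
    proof (intro ballI)
      fix c1 c2
      have 1: "orth_rows {..<p1} {..<p1} (of_nat (p1 ^ (N1 - 1))) (chain p1 N1 (vertex1 (lab c1 c2) \<theta>) edge1)"
        by (rule orth_rows_chain)
          (use n assms(1) in \<open>auto simp: vertex1_def edge1_def[abs_def] norm_mult orth_rows_edge_iff\<close>)
      have 2: "orth_rows {..<p2} {..<p2} (of_nat (p2 ^ (N2 - 1))) (chain p2 N2 (vertex2 (lab c1 c2) \<theta>) edge2)"
        by (rule orth_rows_chain)
          (use n assms(2) in \<open>auto simp: vertex2_def edge2_def[abs_def] norm_mult orth_rows_edge_iff\<close>)
      show "orth_rows ({..<p1} \<times> {..<p2}) ({..<p1} \<times> {..<p2}) ?s (kernel \<theta> c1 c2)"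
        unfolding kernel_def by (rule orth_rows_tensor[OF 1 2]) (rule norm_link)
    qed
    then have "orth_rows I I ?s (\<lambda>E S. block \<theta> S E)"
      by (rule orth_rows_transpose[OF _ s finite_I finite_I refl])
    then have "orth_rows {..<M} I (of_nat M * (?s * of_nat M))
        (\<lambda>t d. \<Sum>E\<in>I. chi p1 n1 p2 n2 (digits p1 n1 p2 n2 t) E *
          (\<Sum>S\<in>I. block \<theta> S E * chi p1 n1 p2 n2 S d))"
      by (intro orth_rows_mult orth_rows_digits orth_rows_chi finite_I)
    moreover have "of_nat M * (?s * of_nat M) = (of_nat (M * L) :: complex)"
    proof -
      \<comment> \<open>Each exponent splits as \<open>m = (n + 1) + (N - 1)\<close>, so
        \<open>L\<close> is \<open>M\<close> times the scale of the block matrix.\<close>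
      have e: "p1 ^ m1 = p1 ^ (n1 + 1) * p1 ^ (N1 - 1)" "p2 ^ m2 = p2 ^ (n2 + 1) * p2 ^ (N2 - 1)"
        using n by (simp_all flip: power_add power_Suc)
      have "M * L = M * (p1 ^ (N1 - 1) * p2 ^ (N2 - 1) * M)"
        unfolding e by (simp only: ac_simps)
      then show ?thesis by (simp only: of_nat_mult)
    qed
    ultimately show ?thesis unfolding spectrum_orth_iff by (simp only:)
  qed
  then show ?thesis using p card_I finite_I by (subst is_CCC_iff_spectrum) auto
qed

section \<open>Necessity of the permutation conditions\<close>

lemma inj_on_path_index:
  assumes c: "c1 \<in> Zvec p1 n1" "c2 \<in> Zvec p2 n2"
  shows "inj_on (\<lambda>y. \<Sum>i=1..N1. y i * W (\<pi> (lab c1 c2) i)) (Zvec p1 N1)" (is ?A)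
    and "inj_on (\<lambda>z. \<Sum>i=1..N2. z i * W (\<pi>' (lab c1 c2) i)) (Zvec p2 N2)" (is ?B)
proof -
  let ?c = "lab c1 c2"
  have lc: "?c < p1 ^ n1 * p2 ^ n2" by (rule label_less[OF c])
  note split = J1(2) \<pi>[OF lc] J1(1) J2(2) \<pi>'[OF lc] J2(1)
  let ?X = "{x\<in>box p1 m1 p2 m2. subvec j1 n1 x = c1 \<and> subvec j2 n2 x = c2}"
  have bij: "(\<lambda>x. (subvec (\<pi> ?c) N1 x, subvec (\<pi>' ?c) N2 x)) ` ?X = Zvec p1 N1 \<times> Zvec p2 N2"
    by (rule bij_betw_imp_surj_on[OF bij_betw_fibre[OF bij_betw_box_split[OF split] c]])
  \<comment> \<open>Within the fibre of \<open>(c1, c2)\<close> the restricted variables contribute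
    a constant to the index, so equal path sums mean equal indices and hence equal points.\<close>
  have *: "y = y' \<and> z = z'"
    if y: "y \<in> Zvec p1 N1" "y' \<in> Zvec p1 N1" and z: "z \<in> Zvec p2 N2" "z' \<in> Zvec p2 N2"
      and eq: "(\<Sum>i=1..N1. y i * W (\<pi> ?c i)) + (\<Sum>i=1..N2. z i * W (\<pi>' ?c i))
        = (\<Sum>i=1..N1. y' i * W (\<pi> ?c i)) + (\<Sum>i=1..N2. z' i * W (\<pi>' ?c i))" for y y' z z'
  proof -
    have "(y, z) \<in> (\<lambda>x. (subvec (\<pi> ?c) N1 x, subvec (\<pi>' ?c) N2 x)) ` ?X"
      "(y', z') \<in> (\<lambda>x. (subvec (\<pi> ?c) N1 x, subvec (\<pi>' ?c) N2 x)) ` ?X"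
      unfolding bij using y z by auto
    then obtain x x' where x: "x \<in> ?X" "y = subvec (\<pi> ?c) N1 x" "z = subvec (\<pi>' ?c) N2 x"
      and x': "x' \<in> ?X" "y' = subvec (\<pi> ?c) N1 x'" "z' = subvec (\<pi>' ?c) N2 x'" by blast
    have "index p1 m1 p2 m2 x = index p1 m1 p2 m2 x'"
      unfolding index_split[OF split] using eq x x' by simp
    then have "x = x'" using inj_onD[OF inj_on_index[OF p]] x(1) x'(1) by blast
    then show ?thesis using x x' by simp
  qed
  \<comment> \<open>Putting the zero path on the other side isolates the sum over one path.\<close>
  have zero: "(\<lambda>i\<in>{1..N1}. 0) \<in> Zvec p1 N1" "(\<lambda>i\<in>{1..N2}. 0) \<in> Zvec p2 N2"
    using p by (auto simp: Zvec_def)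
  show ?A by (rule inj_onI) (use *[OF _ _ zero(2) zero(2)] in auto)
  show ?B by (rule inj_onI) (use *[OF zero(1) zero(1)] in auto)
qed

lemma permutes_if_CCC:
  assumes "is_CCC I M L (\<lambda>t d. seq_of q p1 m1 p2 m2 (C t d))"
  shows "\<forall>i\<in>{1..N1 - 1}. permutes_mod p1 (fs i) \<and> permutes_mod p1 (fs' i)"
    and "\<forall>j\<in>{1..N2 - 1}. permutes_mod p2 (hs j) \<and> permutes_mod p2 (hs' j)"
proof -
  have L: "L > 0" and M: "M > 0" using p by auto
  let ?s = "of_nat (M * L) / of_nat M / of_nat M :: complex"
  have s: "?s \<noteq> 0" "of_nat (M * L) \<noteq> (0 :: complex)" "of_nat M \<noteq> (0 :: complex)"
    using p by auto
  have card: "card {..<M} = card I" by (simp only: card_I card_lessThan)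
  \<comment> \<open>The edges are the same in all blocks, so one block decides; the zero vectors
    name one.\<close>
  define c1 c2 :: "nat \<Rightarrow> nat" where "c1 = (\<lambda>i\<in>{1..n1}. 0)" and "c2 = (\<lambda>i\<in>{1..n2}. 0)"
  have c: "c1 \<in> Zvec p1 n1" "c2 \<in> Zvec p2 n2"
    using p by (auto simp: c1_def c2_def Zvec_def)
  have K: "orth_rows ({..<p1} \<times> {..<p2}) ({..<p1} \<times> {..<p2}) ?s (kernel \<theta> c1 c2)" for \<theta>
  proof -
    have "orth_rows {..<M} I (of_nat (M * L)) (\<lambda>t d. \<Sum>E\<in>I. chi p1 n1 p2 n2 (digits p1 n1 p2 n2 t) E *
        (\<Sum>S\<in>I. block \<theta> S E * chi p1 n1 p2 n2 S d))"
      using assms unfolding is_CCC_iff_spectrum[OF L] spectrum_orth_iff by blast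
    \<comment> \<open>Both character tables are stripped off, each dividing the scale by
      \<open>M\<close>.\<close>
    from orth_rows_cancel_left[OF this orth_rows_digits s(3) finite_lessThan finite_I card]
    have "orth_rows I I (of_nat (M * L) / of_nat M) (\<lambda>E d. \<Sum>S\<in>I. block \<theta> S E * chi p1 n1 p2 n2 S d)"
      using M by (auto simp: lessThan_empty_iff)
    from orth_rows_cancel_right[OF this orth_rows_chi _ s(3) finite_I finite_I finite_I refl refl I_ne]
    have "orth_rows I I ?s (\<lambda>E S. block \<theta> S E)" using s by simp
    from orth_rows_transpose[OF this s(1) finite_I finite_I refl]
    show ?thesis using c unfolding orth_rows_block_iff by blast
  qed
  have ne: "{..<p1} \<noteq> {}" "{..<p2} \<noteq> {}" using p by (auto simp: lessThan_empty_iff)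
  have 1: "orth_rows {..<p1} {..<p1} (of_nat p1) (edge1 i)" if "i \<in> {1..N1 - 1}" for i
  proof (rule chain_edges_orth[where N = N1 and W = "\<lambda>i. W (\<pi> (lab c1 c2) i)" and g = "\<lambda>i u. \<xi> q ^ gs i u"])
    show "\<exists>s. s \<noteq> 0 \<and> orth_rows {..<p1} {..<p1} s
        (chain p1 N1 (\<lambda>i u. \<xi> q ^ gs i u * cis (\<theta> * real (u * W (\<pi> (lab c1 c2) i)))) edge1)" for \<theta>
      unfolding vertex1_eq[symmetric]
      by (rule orth_rows_tensor_left[OF K[unfolded kernel_def] s(1) ne]) (rule norm_link)
  qed (use n p that inj_on_path_index[OF c] in \<open>auto simp: edge1_def\<close>)
  have 2: "orth_rows {..<p2} {..<p2} (of_nat p2) (edge2 i)" if "i \<in> {1..N2 - 1}" for i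
  proof (rule chain_edges_orth[where N = N2 and W = "\<lambda>i. W (\<pi>' (lab c1 c2) i)" and g = "\<lambda>i u. \<xi> q ^ gs' i u"])
    show "\<exists>s. s \<noteq> 0 \<and> orth_rows {..<p2} {..<p2} s
        (chain p2 N2 (\<lambda>i u. \<xi> q ^ gs' i u * cis (\<theta> * real (u * W (\<pi>' (lab c1 c2) i)))) edge2)" for \<theta>
      unfolding vertex2_eq[symmetric]
      by (rule orth_rows_tensor_right[OF K[unfolded kernel_def] s(1) _ _ ne]) (auto simp: norm_link)
  qed (use n p that inj_on_path_index[OF c] in \<open>auto simp: edge2_def\<close>)
  show "\<forall>i\<in>{1..N1 - 1}. permutes_mod p1 (fs i) \<and> permutes_mod p1 (fs' i)"
    using 1 unfolding edge1_def[abs_def] orth_rows_edge_iff by blast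
  show "\<forall>j\<in>{1..N2 - 1}. permutes_mod p2 (hs j) \<and> permutes_mod p2 (hs' j)"
    using 2 unfolding edge2_def[abs_def] orth_rows_edge_iff by blast
qed

end

lemma bij_betw_if_card_eq:
  assumes "inj_on h A" "h \<in> A \<rightarrow> B" "card A = card B" "finite B"
  shows "bij_betw h A B"
proof -
  have "h ` A = B"
    by (rule card_subset_eq) (use assms in \<open>auto simp: card_image\<close>)
  with assms(1) show ?thesis by (simp add: bij_betw_def)
qed

theorem corollary2:
  fixes p1 p2 q m1 m2 m n1 n2 L lam :: nat
    and J1 J2 :: "nat set"
    and j1 j2 :: "nat \<Rightarrow> nat"
    and fs fs' hs hs' gs gs' :: "nat \<Rightarrow> nat \<Rightarrow> nat"
    and f0 h0 :: "nat \<Rightarrow> nat"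
    and \<pi> \<pi>' :: "nat \<Rightarrow> nat \<Rightarrow> nat"
    and f :: "(nat \<Rightarrow> nat) \<Rightarrow> nat"
    and C :: "nat \<Rightarrow> (nat \<Rightarrow> nat) \<times> nat \<times> (nat \<Rightarrow> nat) \<times> nat \<Rightarrow> (nat \<Rightarrow> nat) \<Rightarrow> nat"
  assumes "prime p1" and "prime p2" and "p1 < p2" and "q = p1 * p2"
    and "m1 > 0" and "m2 > 0" and "m = m1 + m2" and "L = p1 ^ m1 * p2 ^ m2"
    and "n1 \<le> m1 - 1" and "n2 \<le> m2 - 1"
    and "J1 \<subseteq> {1..m1}" and "card J1 = n1" and "bij_betw j1 {1..n1} J1"
    and "J2 \<subseteq> {m1 + 1..m}" and "card J2 = n2" and "bij_betw j2 {1..n2} J2"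
    and "\<And>i. i \<in> {1..m1 - n1 - 1} \<Longrightarrow> fs i \<in> {..<q} \<rightarrow> {..<q}"
    and "\<And>i. i \<in> {1..m1 - n1 - 1} \<Longrightarrow> fs' i \<in> {..<q} \<rightarrow> {..<q}"
    and "\<And>j. j \<in> {1..m2 - n2 - 1} \<Longrightarrow> hs j \<in> {..<q} \<rightarrow> {..<q}"
    and "\<And>j. j \<in> {1..m2 - n2 - 1} \<Longrightarrow> hs' j \<in> {..<q} \<rightarrow> {..<q}"
    and "f0 \<in> {..<q} \<rightarrow> {..<q}" and "h0 \<in> {..<q} \<rightarrow> {..<q}"
    and "\<And>\<alpha>. \<alpha> \<in> {1..m1 - n1} \<Longrightarrow> gs \<alpha> \<in> {..<q} \<rightarrow> {..<q}"
    and "\<And>\<beta>. \<beta> \<in> {1..m2 - n2} \<Longrightarrow> gs' \<beta> \<in> {..<q} \<rightarrow> {..<q}"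
    and "\<And>c. c < p1 ^ n1 * p2 ^ n2 \<Longrightarrow>
           \<pi> c \<in> {1..m1 - n1} \<rightarrow> {1..m1} - J1 \<and> inj_on (\<pi> c) {1..m1 - n1}"
    and "\<And>c. c < p1 ^ n1 * p2 ^ n2 \<Longrightarrow>
           \<pi>' c \<in> {1..m2 - n2} \<rightarrow> {m1 + 1..m} - J2 \<and> inj_on (\<pi>' c) {1..m2 - n2}"
    and "lam < q"
    and "\<And>c1 c2 c x. c1 \<in> Zvec p1 n1 \<Longrightarrow> c2 \<in> Zvec p2 n2 \<Longrightarrow> c = label p1 n1 p2 n2 c1 c2 \<Longrightarrow>
           x \<in> box p1 m1 p2 m2 \<Longrightarrow> subvec j1 n1 x = c1 \<Longrightarrow> subvec j2 n2 x = c2 \<Longrightarrow>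
           f x = ((q div p1) * (\<Sum>i=1..m1 - n1 - 1. fs i (x (\<pi> c i)) * fs' i (x (\<pi> c (i + 1))))
                  + (\<Sum>\<alpha>=1..m1 - n1. gs \<alpha> (x (\<pi> c \<alpha>)))
                  + (q div p2) * (\<Sum>j=1..m2 - n2 - 1. hs j (x (\<pi>' c j)) * hs' j (x (\<pi>' c (j + 1))))
                  + (\<Sum>\<beta>=1..m2 - n2. gs' \<beta> (x (\<pi>' c \<beta>)))
                  + lam * f0 (x (\<pi> c (m1 - n1))) * h0 (x (\<pi>' c 1))) mod q"
    and "\<And>t t1 t2 d1 e1 d2 e2 c x.
           t1 < p1 ^ (n1 + 1) \<Longrightarrow> t2 < p2 ^ (n2 + 1) \<Longrightarrow> t = t2 * p1 ^ (n1 + 1) + t1 \<Longrightarrow>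
           d1 \<in> Zvec p1 n1 \<Longrightarrow> e1 \<in> {..<p1} \<Longrightarrow> d2 \<in> Zvec p2 n2 \<Longrightarrow> e2 \<in> {..<p2} \<Longrightarrow>
           x \<in> box p1 m1 p2 m2 \<Longrightarrow> c = label p1 n1 p2 n2 (subvec j1 n1 x) (subvec j2 n2 x) \<Longrightarrow>
           C t (d1, e1, d2, e2) x =
             (f x
              + (q div p1) * (\<Sum>v=1..n1. (d1 v + digit p1 t1 v) * subvec j1 n1 x v)
              + (q div p2) * (\<Sum>v=1..n2. (d2 v + digit p2 t2 v) * subvec j2 n2 x v)
              + (q div p1) * (e1 * x (\<pi> c 1) + digit p1 t1 (n1 + 1) * x (\<pi> c (m1 - n1)))
              + (q div p2) * (e2 * x (\<pi>' c 1) + digit p2 t2 (n2 + 1) * x (\<pi>' c (m2 - n2)))) mod q"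
  shows "is_CCC (Zvec p1 n1 \<times> {..<p1} \<times> Zvec p2 n2 \<times> {..<p2})
           (p1 ^ (n1 + 1) * p2 ^ (n2 + 1)) L
           (\<lambda>t d. seq_of q p1 m1 p2 m2 (C t d))
         \<longleftrightarrow>
         (\<forall>i\<in>{1..m1 - n1 - 1}. permutes_mod p1 (fs i) \<and> permutes_mod p1 (fs' i)) \<and>
         (\<forall>j\<in>{1..m2 - n2 - 1}. permutes_mod p2 (hs j) \<and> permutes_mod p2 (hs' j))"
proof -
  have p: "p1 > 0" "p2 > 0" using assms(1,2) by (auto intro: prime_gt_0_nat)
  have m: "m = m1 + m2" and n: "n1 < m1" "n2 < m2" using assms(5-7,9,10) by auto
  have card: "card ({1..m1} - J1) = m1 - n1" "card ({m1 + 1..m1 + m2} - J2) = m2 - n2"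
    using assms(11,12,14,15) m by (simp_all add: card_Diff_subset finite_subset)
  \<comment> \<open>The complement of each index set has exactly as many elements as the domain, so
    the injections are onto.\<close>
  have bij: "bij_betw (\<pi> c) {1..m1 - n1} ({1..m1} - J1)"
    "bij_betw (\<pi>' c) {1..m2 - n2} ({m1 + 1..m1 + m2} - J2)" if "c < p1 ^ n1 * p2 ^ n2" for c
    using assms(25)[OF that] assms(26)[OF that] m card
    by (auto intro!: bij_betw_if_card_eq)
  interpret ccc_family p1 p2 q m1 m2 n1 n2 lam J1 J2 j1 j2 fs fs' hs hs' gs gs' f0 h0 \<pi> \<pi>' f C
  proof
    fix c x
    assume x: "x \<in> box p1 m1 p2 m2" and c: "c = label p1 n1 p2 n2 (subvec j1 n1 x) (subvec j2 n2 x)"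
    have "subvec j1 n1 x \<in> Zvec p1 n1" "subvec j2 n2 x \<in> Zvec p2 n2"
      using subvec_box[OF x assms(13)] subvec_box[OF x assms(16)] assms(11,14) unfolding m by blast+
    from assms(28)[OF this c x refl refl]
    show "f x = ((q div p1) * (\<Sum>i=1..m1 - n1 - 1. fs i (x (\<pi> c i)) * fs' i (x (\<pi> c (i + 1))))
             + (\<Sum>\<alpha>=1..m1 - n1. gs \<alpha> (x (\<pi> c \<alpha>)))
             + (q div p2) * (\<Sum>j=1..m2 - n2 - 1. hs j (x (\<pi>' c j)) * hs' j (x (\<pi>' c (j + 1))))
             + (\<Sum>\<beta>=1..m2 - n2. gs' \<beta> (x (\<pi>' c \<beta>)))
             + lam * f0 (x (\<pi> c (m1 - n1))) * h0 (x (\<pi>' c 1))) mod q" .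
  next
    show "J2 \<subseteq> {m1 + 1..m1 + m2}" using assms(14) unfolding m .
  qed (fact p n bij assms)+
  show ?thesis
    unfolding assms(8) using CCC_if_permutes permutes_if_CCC by blast
qed

end
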